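(* Let $E$ be a row-finite graph (possibly with sinks) and let $F$ be a graph which is explosion equivalent to $E$. Then $C^*(E)\cong C^*(F)$.
   Context: Graphs. A directed graph $E$ consists of a vertex set $E^0$, an edge set $E^1$ and source and range maps $s,r:E^1\to E^0$. Throughout, "graph" means a countable directed graph without multiple edges (at most one edge from $v$ to $w$ for each ordered pair $(v,w)$; loops allowed) which is connected (any two vertices are joined by an undirected path). $E$ is row-finite if every vertex is the source of only finitely many edges; a sink is a vertex which is the source of no edge. Edge explosion. Let $v\in E^0$ with $|s^{-1}(v)|>1$ and let $e$ be an edge with source $v$; put $M_1=\{e\}$ and $M_2=s^{-1}(v)\setminus\{e\}$. The edge explosion $F$ of $E$ at $e$ has vertex set $F^0=(E^0\setminus\{v\})\cup\{v',v''\}$ and the following edges: all edges of $E$ with neither source nor range equal to $v$; for each edge of $E$ from a vertex $u\ne v$ to $v$, one edge from $u$ to $v'$ and one from $u$ to $v''$; for each edge in $M_1$ from $v$ to $w\neq v$, an edge from $v'$ to $w$; for each edge in $M_2$ from $v$ to $w\ne v$, an edge from $v''$ to $w$; if the loop at $v$ exists and lies in $M_1$ (i.e. equals $e$), a loop at $v'$ and an edge from $v'$ to $v''$; if it lies in $M_2$, a loop at $v''$ and an edge from $v''$ to $v'$. Explosion equivalence. Graphs $E$ and $G$ are explosion equivalent if there is a finite sequence $E=F_0,F_1,\dots,F_n=G$ of graphs such that for every $i$, either $F_i$ is an edge explosion of $F_{i+1}$ or $F_{i+1}$ is an edge explosion of $F_i$. Graph algebra. For a row-finite graph $E$, a Cuntz-Krieger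 $E$-family consists of mutually orthogonal projections $\{P_v: v\in E^0\}$ and partial isometries $\{S_e:e\in E^1\}$ with $S_e^*S_e=P_{r(e)}$ for all $e$, and $P_v=\sum_{s(e)=v}S_eS_e^*$ for every $v\in s(E^1)$. $C^*(E)$ is the universal $C^*$-algebra generated by a Cuntz-Krieger $E$-family. *)

theory Defs
  imports
    Complex_Main
    "HOL-Library.Countable_Set"
    "HOL-Algebra.Module"
    "Graph_Theory.Digraph_Component"
    "Graph_Theory.Digraph_Isomorphism"
begin

section \<open>Graphs\<close>

locale countable_graph = nomulti_digraph E for E :: "('a, 'b) pre_digraph" (structure) +
  assumes countable_verts: "countable (verts E)"
    and countable_arcs: "countable (arcs E)"
    and undirected_path:
      "\<lbrakk>u \<in> verts E; v \<in> verts E\<rbrakk> \<Longrightarrow> u \<rightarrow>\<^sup>*\<^bsub>with_proj (mk_symmetric E)\<^esub> v"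

definition row_finite :: "('a, 'b) pre_digraph \<Rightarrow> bool" where
  "row_finite E \<longleftrightarrow> (\<forall>v \<in> verts E. finite (out_arcs E v))"


section \<open>Edge explosions\<close>

datatype 'a exploded = Old 'a | Primed | Doubly_Primed

text \<open>With \<open>v = tail E e\<close>, the constructors \<open>Primed\<close> and \<open>Doubly_Primed\<close> are the new vertices
  \<open>v'\<close> and \<open>v''\<close>. As there are no multiple edges, the edges of the explosion are represented by
  their ordered pairs of end points. The sets of edges leaving \<open>v\<close> are \<open>M\<^sub>1 = {e}\<close> and
  \<open>M\<^sub>2 = out_arcs E v - {e}\<close>.\<close>

definition explode :: "('a, 'b) pre_digraph \<Rightarrow> 'b \<Rightarrow> ('a exploded, 'a exploded \<times> 'a exploded) pre_digraph"
  where
  "explode E e =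
    (let v = tail E e; M\<^sub>1 = {e}; M\<^sub>2 = out_arcs E v - {e} in
     \<lparr> verts = Old ` (verts E - {v}) \<union> {Primed, Doubly_Primed},
       arcs =
           {(Old (tail E f), Old (head E f)) |f. f \<in> arcs E \<and> tail E f \<noteq> v \<and> head E f \<noteq> v}
         \<union> {(Old (tail E f), Primed) |f. f \<in> arcs E \<and> tail E f \<noteq> v \<and> head E f = v}
         \<union> {(Old (tail E f), Doubly_Primed) |f. f \<in> arcs E \<and> tail E f \<noteq> v \<and> head E f = v}
         \<union> {(Primed, Old (head E f)) |f. f \<in> M\<^sub>1 \<and> head E f \<noteq> v}
         \<union> {(Doubly_Primed, Old (head E f)) |f. f \<in> M\<^sub>2 \<and> head E f \<noteq> v}
         \<union> {(Primed, w) |f w. f \<in> M\<^sub>1 \<and> head E f = v \<and> w \<in> {Primed, Doubly_Primed}}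
         \<union> {(Doubly_Primed, w) |f w. f \<in> M\<^sub>2 \<and> head E f = v \<and> w \<in> {Primed, Doubly_Primed}},
       tail = fst,
       head = snd \<rparr>)"

text \<open>The new vertices are anonymous, so explosions are taken up to isomorphism. For \<open>e \<in> arcs E\<close>,
  \<open>out_arcs E (tail E e) \<noteq> {e}\<close> says that the source of \<open>e\<close> emits more than one edge, also
  when it emits infinitely many.\<close>

definition is_edge_explosion :: "('c, 'd) pre_digraph \<Rightarrow> ('a, 'b) pre_digraph \<Rightarrow> bool" where
  "is_edge_explosion F E \<longleftrightarrow>
    (\<exists>e \<in> arcs E. out_arcs E (tail E e) \<noteq> {e} \<and> digraph_iso (explode E e) F)"

text \<open>All graphs being countable, it is no restriction to let the intermediate graphs have natural
  numbers as vertices and edges. The ends of the sequence are identified with \<open>E\<close> and \<open>G\<close> by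
  isomorphisms, as these may be graphs over other types.\<close>

definition explosion_equivalent :: "('a, 'b) pre_digraph \<Rightarrow> ('c, 'd) pre_digraph \<Rightarrow> bool" where
  "explosion_equivalent E G \<longleftrightarrow>
    (\<exists>(n :: nat) (F :: nat \<Rightarrow> (nat, nat) pre_digraph).
       (\<forall>i \<le> n. countable_graph (F i)) \<and>
       digraph_iso E (F 0) \<and> digraph_iso (F n) G \<and>
       (\<forall>i < n. is_edge_explosion (F i) (F (Suc i)) \<or> is_edge_explosion (F (Suc i)) (F i)))"


section \<open>C*-algebras\<close>

text \<open>The field \<open>one\<close> inherited from the records of HOL-Algebra is ignored throughout: C*-algebras
  are not assumed to be unital, and homomorphisms are not required to preserve a unit.\<close>

record 'a cstar = "(complex, 'a) module" +
  adj :: "'a \<Rightarrow> 'a"  (\<open>adj\<index> _\<close> [81] 80)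
  cnorm :: "'a \<Rightarrow> real"  (\<open>\<parallel>_\<parallel>\<index>\<close>)

definition norm_convergent_to :: "'a cstar \<Rightarrow> (nat \<Rightarrow> 'a) \<Rightarrow> 'a \<Rightarrow> bool" where
  "norm_convergent_to A x l \<longleftrightarrow> (\<lambda>n. \<parallel>x n \<ominus>\<^bsub>A\<^esub> l\<parallel>\<^bsub>A\<^esub>) \<longlonglongrightarrow> 0"

definition norm_Cauchy :: "'a cstar \<Rightarrow> (nat \<Rightarrow> 'a) \<Rightarrow> bool" where
  "norm_Cauchy A x \<longleftrightarrow> (\<forall>\<epsilon>>0. \<exists>N. \<forall>m\<ge>N. \<forall>n\<ge>N. \<parallel>x m \<ominus>\<^bsub>A\<^esub> x n\<parallel>\<^bsub>A\<^esub> < \<epsilon>)"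

locale cstar_algebra = abelian_group A for A :: "'a cstar" (structure) +
  assumes smult_closed: "x \<in> carrier A \<Longrightarrow> c \<odot> x \<in> carrier A"
    and smult_add_right:
      "\<lbrakk>x \<in> carrier A; y \<in> carrier A\<rbrakk> \<Longrightarrow> c \<odot> (x \<oplus> y) = c \<odot> x \<oplus> c \<odot> y"
    and smult_add_left: "x \<in> carrier A \<Longrightarrow> (c + d) \<odot> x = c \<odot> x \<oplus> d \<odot> x"
    and smult_smult: "x \<in> carrier A \<Longrightarrow> c \<odot> (d \<odot> x) = (c * d) \<odot> x"
    and smult_1: "x \<in> carrier A \<Longrightarrow> 1 \<odot> x = x"
    and mult_closed: "\<lbrakk>x \<in> carrier A; y \<in> carrier A\<rbrakk> \<Longrightarrow> x \<otimes> y \<in> carrier A"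
    and mult_assoc:
      "\<lbrakk>x \<in> carrier A; y \<in> carrier A; z \<in> carrier A\<rbrakk> \<Longrightarrow> (x \<otimes> y) \<otimes> z = x \<otimes> (y \<otimes> z)"
    and mult_add_left:
      "\<lbrakk>x \<in> carrier A; y \<in> carrier A; z \<in> carrier A\<rbrakk> \<Longrightarrow> (x \<oplus> y) \<otimes> z = x \<otimes> z \<oplus> y \<otimes> z"
    and mult_add_right:
      "\<lbrakk>x \<in> carrier A; y \<in> carrier A; z \<in> carrier A\<rbrakk> \<Longrightarrow> x \<otimes> (y \<oplus> z) = x \<otimes> y \<oplus> x \<otimes> z"
    and mult_smult_left:
      "\<lbrakk>x \<in> carrier A; y \<in> carrier A\<rbrakk> \<Longrightarrow> (c \<odot> x) \<otimes> y = c \<odot> (x \<otimes> y)"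
    and mult_smult_right:
      "\<lbrakk>x \<in> carrier A; y \<in> carrier A\<rbrakk> \<Longrightarrow> x \<otimes> (c \<odot> y) = c \<odot> (x \<otimes> y)"
    and adj_closed: "x \<in> carrier A \<Longrightarrow> adj x \<in> carrier A"
    and adj_adj: "x \<in> carrier A \<Longrightarrow> adj (adj x) = x"
    and adj_add: "\<lbrakk>x \<in> carrier A; y \<in> carrier A\<rbrakk> \<Longrightarrow> adj (x \<oplus> y) = adj x \<oplus> adj y"
    and adj_smult: "x \<in> carrier A \<Longrightarrow> adj (c \<odot> x) = cnj c \<odot> adj x"
    and adj_mult: "\<lbrakk>x \<in> carrier A; y \<in> carrier A\<rbrakk> \<Longrightarrow> adj (x \<otimes> y) = adj y \<otimes> adj x"
    and norm_nonneg: "x \<in> carrier A \<Longrightarrow> 0 \<le> \<parallel>x\<parallel>"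
    and norm_eq_0_iff: "x \<in> carrier A \<Longrightarrow> \<parallel>x\<parallel> = 0 \<longleftrightarrow> x = \<zero>"
    and norm_triangle: "\<lbrakk>x \<in> carrier A; y \<in> carrier A\<rbrakk> \<Longrightarrow> \<parallel>x \<oplus> y\<parallel> \<le> \<parallel>x\<parallel> + \<parallel>y\<parallel>"
    and norm_smult: "x \<in> carrier A \<Longrightarrow> \<parallel>c \<odot> x\<parallel> = cmod c * \<parallel>x\<parallel>"
    and norm_mult_le: "\<lbrakk>x \<in> carrier A; y \<in> carrier A\<rbrakk> \<Longrightarrow> \<parallel>x \<otimes> y\<parallel> \<le> \<parallel>x\<parallel> * \<parallel>y\<parallel>"
    and norm_adj_mult: "x \<in> carrier A \<Longrightarrow> \<parallel>adj x \<otimes> x\<parallel> = \<parallel>x\<parallel>\<^sup>2"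
    and norm_complete:
      "\<lbrakk>range X \<subseteq> carrier A; norm_Cauchy A X\<rbrakk> \<Longrightarrow> \<exists>l \<in> carrier A. norm_convergent_to A X l"

definition star_hom :: "'a cstar \<Rightarrow> 'b cstar \<Rightarrow> ('a \<Rightarrow> 'b) \<Rightarrow> bool" where
  "star_hom A B \<phi> \<longleftrightarrow>
    \<phi> \<in> carrier A \<rightarrow> carrier B \<and>
    (\<forall>x \<in> carrier A. \<forall>y \<in> carrier A.
       \<phi> (x \<oplus>\<^bsub>A\<^esub> y) = \<phi> x \<oplus>\<^bsub>B\<^esub> \<phi> y \<and> \<phi> (x \<otimes>\<^bsub>A\<^esub> y) = \<phi> x \<otimes>\<^bsub>B\<^esub> \<phi> y) \<and>
    (\<forall>x \<in> carrier A. \<forall>c. \<phi> (c \<odot>\<^bsub>A\<^esub> x) = c \<odot>\<^bsub>B\<^esub> \<phi> x) \<and>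
    (\<forall>x \<in> carrier A. \<phi> (adj\<^bsub>A\<^esub> x) = adj\<^bsub>B\<^esub> (\<phi> x))"

text \<open>Injective *-homomorphisms of C*-algebras are isometric, so the norm need not be mentioned.\<close>

definition cstar_isomorphic :: "'a cstar \<Rightarrow> 'b cstar \<Rightarrow> bool" where
  "cstar_isomorphic A B \<longleftrightarrow> (\<exists>\<phi>. star_hom A B \<phi> \<and> bij_betw \<phi> (carrier A) (carrier B))"

definition closed_star_subalgebra :: "'a cstar \<Rightarrow> 'a set \<Rightarrow> bool" where
  "closed_star_subalgebra A B \<longleftrightarrow>
    B \<subseteq> carrier A \<and> \<zero>\<^bsub>A\<^esub> \<in> B \<and>
    (\<forall>x \<in> B. \<forall>y \<in> B. x \<oplus>\<^bsub>A\<^esub> y \<in> B \<and> x \<otimes>\<^bsub>A\<^esub> y \<in> B) \<and>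
    (\<forall>x \<in> B. \<forall>c. c \<odot>\<^bsub>A\<^esub> x \<in> B) \<and>
    (\<forall>x \<in> B. adj\<^bsub>A\<^esub> x \<in> B) \<and>
    (\<forall>X. \<forall>l \<in> carrier A. range X \<subseteq> B \<and> norm_convergent_to A X l \<longrightarrow> l \<in> B)"

definition generates_cstar :: "'a cstar \<Rightarrow> 'a set \<Rightarrow> bool" where
  "generates_cstar A X \<longleftrightarrow>
    X \<subseteq> carrier A \<and> (\<forall>B. closed_star_subalgebra A B \<and> X \<subseteq> B \<longrightarrow> B = carrier A)"

definition projection :: "'a cstar \<Rightarrow> 'a \<Rightarrow> bool" where
  "projection A p \<longleftrightarrow> p \<in> carrier A \<and> p \<otimes>\<^bsub>A\<^esub> p = p \<and> adj\<^bsub>A\<^esub> p = p"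

definition partial_isometry :: "'a cstar \<Rightarrow> 'a \<Rightarrow> bool" where
  "partial_isometry A s \<longleftrightarrow> s \<in> carrier A \<and> s \<otimes>\<^bsub>A\<^esub> adj\<^bsub>A\<^esub> s \<otimes>\<^bsub>A\<^esub> s = s"


section \<open>The C*-algebra of a graph\<close>

definition cuntz_krieger_family ::
    "('v, 'e) pre_digraph \<Rightarrow> 'a cstar \<Rightarrow> ('v \<Rightarrow> 'a) \<Rightarrow> ('e \<Rightarrow> 'a) \<Rightarrow> bool" where
  "cuntz_krieger_family E A P S \<longleftrightarrow>
    (\<forall>v \<in> verts E. projection A (P v)) \<and>
    (\<forall>v \<in> verts E. \<forall>w \<in> verts E. v \<noteq> w \<longrightarrow> P v \<otimes>\<^bsub>A\<^esub> P w = \<zero>\<^bsub>A\<^esub>) \<and>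
    (\<forall>e \<in> arcs E. partial_isometry A (S e)) \<and>
    (\<forall>e \<in> arcs E. adj\<^bsub>A\<^esub> (S e) \<otimes>\<^bsub>A\<^esub> S e = P (head E e)) \<and>
    (\<forall>v \<in> tail E ` arcs E. P v = (\<Oplus>\<^bsub>A\<^esub>e \<in> out_arcs E v. S e \<otimes>\<^bsub>A\<^esub> adj\<^bsub>A\<^esub> (S e)))"

text \<open>\<open>is_graph_algebra E A\<close> means that \<open>A\<close> is (a copy of) C*(E). The universal property has to be
  stated for target algebras over one fixed type. Taking the reals loses nothing: a Cuntz-Krieger
  family of a countable graph generates a separable C*-algebra, which has at most continuum many
  elements and hence is isomorphic to one whose carrier is a set of reals.\<close>

definition is_graph_algebra :: "('v, 'e) pre_digraph \<Rightarrow> 'a cstar \<Rightarrow> bool" where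
  "is_graph_algebra E A \<longleftrightarrow> cstar_algebra A \<and>
    (\<exists>P S. cuntz_krieger_family E A P S \<and>
       generates_cstar A (P ` verts E \<union> S ` arcs E) \<and>
       (\<forall>(B :: real cstar) Q T. cstar_algebra B \<and> cuntz_krieger_family E B Q T \<longrightarrow>
          (\<exists>\<phi>. star_hom A B \<phi> \<and>
             (\<forall>v \<in> verts E. \<phi> (P v) = Q v) \<and> (\<forall>e \<in> arcs E. \<phi> (S e) = T e))))"

end

theory Submission
  imports Defs "HOL-Analysis.Abstract_Topology_2" "HOL-Analysis.Topology_Euclidean_Space"
begin

text \<open>
  An edge explosion is an out-splitting: the edges leaving a vertex are distributed over the copies
  of this vertex, while the edges entering it are duplicated. For a row-finite graph, Cuntz-Krieger
  families of a graph \<open>E\<close> and of an out-splitting \<open>F\<close> determine each other: from an \<open>E\<close>-family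
  \<open>(P, S)\<close> one obtains an \<open>F\<close>-family by letting \<open>Q y\<close> be the sum of the projections \<open>S f S f\<^sup>*\<close> over
  the edges \<open>f\<close> assigned to the copy \<open>y\<close> (and \<open>P v\<close> if there are none) and by cutting \<open>S f\<close> down
  to \<open>S f Q y\<close> for each copy \<open>y\<close> of its range; summing over the copies recovers \<open>(P, S)\<close>. Both
  families generate the same algebra, so C*(E) has the universal property of C*(F), and conversely.
  As a graph algebra is unique up to isomorphism, the theorem follows by induction on the number of
  explosions.

  Uniqueness rests on two facts: *-homomorphisms are contractive, and a countably generated C*-algebra
  has at most continuum many elements, so that it has a copy on a set of reals, as the universal
  property demands.
\<close>

section \<open>Norm and convergence in C*-algebras\<close>

text \<open>The relations only say that the range projections of the edges leaving a vertex add up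
  to a projection, and the algebras carry neither an order nor a distinguished unit. Positivity and
  spectral arguments are therefore replaced by the C*-identity, by which \<open>x\<close> vanishes
  as soon as \<open>adj x \<otimes> x\<close> does. Contractivity is read off from an algebraic
  certificate: a self-adjoint \<open>h\<close> of norm below 1 has a self-adjoint companion
  \<open>s\<close> that commutes with it and satisfies
  \<open>h \<otimes> h \<oplus> s \<otimes> s = s \<oplus> s\<close>; conversely, a self-adjoint
  element with such a companion has norm at most 1. Homomorphisms preserve the certificate.

  On the side of graphs, out-splittings include isomorphisms, as the case of one copy per vertex, so
  the renamings in a chain of explosions are covered as well. Each of several copies of a vertex
  must emit an edge; otherwise the range projections would not distribute the projection of the
  vertex over all its copies. As a step of the chain may go either way, row-finiteness has to travel
  in both directions along with the algebra.\<close>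

context cstar_algebra
begin

lemmas [simp] = smult_closed mult_closed adj_closed adj_adj

lemma zero_smult [simp]: "x \<in> carrier A \<Longrightarrow> 0 \<odot> x = \<zero>"
  using smult_add_left[of x 0 0] by simp

lemma smult_zero [simp]: "c \<odot> \<zero> = \<zero>"
  using smult_add_right[of \<zero> \<zero> c] by simp

lemma mult_zero_left [simp]: "x \<in> carrier A \<Longrightarrow> \<zero> \<otimes> x = \<zero>"
  using mult_add_left[of \<zero> \<zero> x] by simp

lemma mult_zero_right [simp]: "x \<in> carrier A \<Longrightarrow> x \<otimes> \<zero> = \<zero>"
  using mult_add_right[of x \<zero> \<zero>] by simp

lemma adj_zero [simp]: "adj \<zero> = \<zero>"
  using adj_add[of \<zero> \<zero>] by simp

lemma a_inv_eq_smult: "x \<in> carrier A \<Longrightarrow> \<ominus> x = (-1) \<odot> x"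
  using smult_add_left[of x "-1" 1] by (intro minus_equality) (auto simp: smult_1)

lemma mult_a_inv_left [simp]:
  "\<lbrakk>x \<in> carrier A; y \<in> carrier A\<rbrakk> \<Longrightarrow> (\<ominus> x) \<otimes> y = \<ominus> (x \<otimes> y)"
  by (simp add: a_inv_eq_smult mult_smult_left)

lemma mult_a_inv_right [simp]:
  "\<lbrakk>x \<in> carrier A; y \<in> carrier A\<rbrakk> \<Longrightarrow> x \<otimes> (\<ominus> y) = \<ominus> (x \<otimes> y)"
  by (simp add: a_inv_eq_smult mult_smult_right)

lemma adj_a_inv [simp]: "x \<in> carrier A \<Longrightarrow> adj (\<ominus> x) = \<ominus> (adj x)"
  by (simp add: a_inv_eq_smult adj_smult)

lemma smult_a_inv [simp]: "x \<in> carrier A \<Longrightarrow> c \<odot> (\<ominus> x) = \<ominus> (c \<odot> x)"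
  by (simp add: a_inv_eq_smult smult_smult mult.commute)

lemma mult_diff_left:
  "\<lbrakk>x \<in> carrier A; y \<in> carrier A; z \<in> carrier A\<rbrakk> \<Longrightarrow> (x \<ominus> y) \<otimes> z = x \<otimes> z \<ominus> y \<otimes> z"
  by (simp add: a_minus_def mult_add_left)

lemma mult_diff_right:
  "\<lbrakk>x \<in> carrier A; y \<in> carrier A; z \<in> carrier A\<rbrakk> \<Longrightarrow> x \<otimes> (y \<ominus> z) = x \<otimes> y \<ominus> x \<otimes> z"
  by (simp add: a_minus_def mult_add_right)

lemma smult_diff_right:
  "\<lbrakk>x \<in> carrier A; y \<in> carrier A\<rbrakk> \<Longrightarrow> c \<odot> (x \<ominus> y) = c \<odot> x \<ominus> c \<odot> y"
  by (simp add: a_minus_def smult_add_right)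

lemma smult_diff_left:
  assumes "x \<in> carrier A"
  shows "(c - d) \<odot> x = c \<odot> x \<ominus> d \<odot> x"
proof -
  have "\<ominus> (d \<odot> x) = (- d) \<odot> x"
    using assms by (simp only: a_inv_eq_smult smult_closed smult_smult mult_minus1)
  moreover have "(c + - d) \<odot> x = c \<odot> x \<oplus> (- d) \<odot> x"
    using assms by (rule smult_add_left)
  ultimately show ?thesis
    unfolding a_minus_def by (simp only: diff_conv_add_uminus)
qed

lemma adj_diff: "\<lbrakk>x \<in> carrier A; y \<in> carrier A\<rbrakk> \<Longrightarrow> adj (x \<ominus> y) = adj x \<ominus> adj y"
  by (simp add: a_minus_def adj_add)

lemma diff_self [simp]: "x \<in> carrier A \<Longrightarrow> x \<ominus> x = \<zero>"
  by (simp add: a_minus_def r_neg)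

lemma diff_zero [simp]: "x \<in> carrier A \<Longrightarrow> x \<ominus> \<zero> = x"
  by (simp add: a_minus_def a_inv_eq_smult)

lemma diff_add_diff:
  "\<lbrakk>x \<in> carrier A; y \<in> carrier A; z \<in> carrier A\<rbrakk> \<Longrightarrow> (x \<ominus> z) \<oplus> (z \<ominus> y) = x \<ominus> y"
  by (simp add: a_minus_def a_assoc r_neg1)

lemma add_diff_add:
  "\<lbrakk>x \<in> carrier A; y \<in> carrier A; z \<in> carrier A; w \<in> carrier A\<rbrakk>
    \<Longrightarrow> (x \<oplus> y) \<ominus> (z \<oplus> w) = (x \<ominus> z) \<oplus> (y \<ominus> w)"
  by (simp add: a_minus_def minus_add a_ac)

lemma add_diff_cancel: "\<lbrakk>x \<in> carrier A; y \<in> carrier A\<rbrakk> \<Longrightarrow> x \<oplus> (y \<ominus> x) = y"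
  using a_lcomm[of x y "\<ominus> x"] by (simp add: a_minus_def r_neg)

lemma eq_if_diff_eq_zero: "\<lbrakk>x \<in> carrier A; y \<in> carrier A; x \<ominus> y = \<zero>\<rbrakk> \<Longrightarrow> x = y"
  using add.inv_equality[of x "\<ominus> y"] by (simp add: a_minus_def minus_minus)

lemma norm_zero [simp]: "\<parallel>\<zero>\<parallel> = 0"
  by (simp add: norm_eq_0_iff)

lemma norm_a_inv [simp]: "x \<in> carrier A \<Longrightarrow> \<parallel>\<ominus> x\<parallel> = \<parallel>x\<parallel>"
  by (simp add: a_inv_eq_smult norm_smult)

lemma norm_diff_commute: "\<lbrakk>x \<in> carrier A; y \<in> carrier A\<rbrakk> \<Longrightarrow> \<parallel>x \<ominus> y\<parallel> = \<parallel>y \<ominus> x\<parallel>"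
  using norm_a_inv[of "x \<ominus> y"] by (simp add: a_minus_def minus_add minus_minus a_comm)

lemma norm_diff_triangle:
  "\<lbrakk>x \<in> carrier A; y \<in> carrier A; z \<in> carrier A\<rbrakk> \<Longrightarrow> \<parallel>x \<ominus> y\<parallel> \<le> \<parallel>x \<ominus> z\<parallel> + \<parallel>z \<ominus> y\<parallel>"
  using norm_triangle[of "x \<ominus> z" "z \<ominus> y"] by (simp add: diff_add_diff)

lemma norm_le_norm_diff:
  "\<lbrakk>x \<in> carrier A; y \<in> carrier A\<rbrakk> \<Longrightarrow> \<parallel>x\<parallel> \<le> \<parallel>x \<ominus> y\<parallel> + \<parallel>y\<parallel>"
  using norm_triangle[of "x \<ominus> y" y] by (simp add: a_minus_def a_assoc l_neg)

lemma eq_if_norm_diff_less: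
  assumes "x \<in> carrier A" "y \<in> carrier A" "\<And>\<epsilon>. \<epsilon> > 0 \<Longrightarrow> \<parallel>x \<ominus> y\<parallel> < \<epsilon>"
  shows "x = y"
proof (rule eq_if_diff_eq_zero)
  have "\<parallel>x \<ominus> y\<parallel> = 0"
    using assms norm_nonneg[of "x \<ominus> y"] by (metis less_irrefl less_eq_real_def minus_closed)
  then show "x \<ominus> y = \<zero>"
    using assms by (simp add: norm_eq_0_iff)
qed (use assms in auto)

text \<open>By the C*-identity the square of the norm of \<open>y\<close> is at most the product of
  the norms of \<open>adj y\<close> and \<open>y\<close>; cancelling gives one inequality, and
  applying it to \<open>adj x\<close> gives the other.\<close>

lemma norm_adj [simp]:
  assumes "x \<in> carrier A"
  shows "\<parallel>adj x\<parallel> = \<parallel>x\<parallel>"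
proof -
  have *: "\<parallel>y\<parallel> \<le> \<parallel>adj y\<parallel>" if "y \<in> carrier A" for y
  proof (cases "\<parallel>y\<parallel> = 0")
    case False
    moreover have "\<parallel>y\<parallel> * \<parallel>y\<parallel> \<le> \<parallel>adj y\<parallel> * \<parallel>y\<parallel>"
      using norm_mult_le[of "adj y" y] norm_adj_mult[of y] that by (simp add: power2_eq_square)
    ultimately show ?thesis
      using norm_nonneg[OF that] by simp
  qed (use norm_nonneg that in simp)
  show ?thesis
    using *[of x] *[of "adj x"] assms by simp
qed

text \<open>All four terms in the expansion of
  \<open>adj (x \<ominus> y) \<otimes> (x \<ominus> y)\<close> equal \<open>z\<close> up to sign and
  cancel, so the C*-identity applies. This stands in for positivity when relations between partial
  isometries are derived.\<close>

lemma eq_if_adj_mult_eq: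
  assumes "x \<in> carrier A" "y \<in> carrier A" "adj x \<otimes> x = z" "adj x \<otimes> y = z"
    "adj y \<otimes> x = z" "adj y \<otimes> y = z"
  shows "x = y"
proof (rule eq_if_diff_eq_zero)
  have "z \<in> carrier A"
    using assms by auto
  then have "adj (x \<ominus> y) \<otimes> (x \<ominus> y) = \<zero>"
    using assms by (simp add: adj_diff mult_diff_left mult_diff_right)
  then show "x \<ominus> y = \<zero>"
    using norm_adj_mult[of "x \<ominus> y"] assms by (simp add: norm_eq_0_iff)
qed (use assms in auto)

lemma norm_convergent_to_unique:
  assumes "range X \<subseteq> carrier A" "l \<in> carrier A" "m \<in> carrier A"
    and "norm_convergent_to A X l" "norm_convergent_to A X m"
  shows "l = m"
proof -
  have X: "X n \<in> carrier A" for n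
    using assms by auto
  have "(\<lambda>n. \<parallel>X n \<ominus> l\<parallel> + \<parallel>X n \<ominus> m\<parallel>) \<longlonglongrightarrow> 0 + 0"
    using assms unfolding norm_convergent_to_def by (intro tendsto_add)
  then have "\<parallel>l \<ominus> m\<parallel> \<le> 0 + 0"
    by (rule LIMSEQ_le_const)
      (use norm_diff_triangle[of l m "X _"] norm_diff_commute[of l "X _"] assms X in auto)
  then have "l \<ominus> m = \<zero>"
    using assms norm_nonneg[of "l \<ominus> m"] norm_eq_0_iff[of "l \<ominus> m"] by simp
  then show ?thesis
    using assms eq_if_diff_eq_zero by blast
qed

lemma norm_convergent_to_squeeze:
  assumes "range X \<subseteq> carrier A" "l \<in> carrier A"
    and "\<And>n. \<parallel>X n \<ominus> l\<parallel> \<le> b n" "b \<longlonglongrightarrow> 0"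
  shows "norm_convergent_to A X l"
  unfolding norm_convergent_to_def
  by (rule tendsto_sandwich[of "\<lambda>_. 0" _ _ b])
    (use assms norm_nonneg in \<open>auto simp: image_subset_iff\<close>)

lemma norm_convergent_to_add:
  assumes "range X \<subseteq> carrier A" "l \<in> carrier A" "range Y \<subseteq> carrier A" "m \<in> carrier A"
    and "norm_convergent_to A X l" "norm_convergent_to A Y m"
  shows "norm_convergent_to A (\<lambda>n. X n \<oplus> Y n) (l \<oplus> m)"
proof (rule norm_convergent_to_squeeze)
  have X: "X n \<in> carrier A" "Y n \<in> carrier A" for n
    using assms by auto
  then show "\<parallel>X n \<oplus> Y n \<ominus> (l \<oplus> m)\<parallel> \<le> \<parallel>X n \<ominus> l\<parallel> + \<parallel>Y n \<ominus> m\<parallel>" for n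
    using assms by (simp add: add_diff_add norm_triangle)
  show "(\<lambda>n. \<parallel>X n \<ominus> l\<parallel> + \<parallel>Y n \<ominus> m\<parallel>) \<longlonglongrightarrow> 0"
    using tendsto_add[OF assms(5,6)[unfolded norm_convergent_to_def]] by simp
qed (use assms in auto)

text \<open>Only one factor is changed at a time, by inserting \<open>l \<otimes> y\<close>.\<close>

lemma norm_mult_diff_le:
  assumes "x \<in> carrier A" "y \<in> carrier A" "l \<in> carrier A" "m \<in> carrier A"
  shows "\<parallel>x \<otimes> y \<ominus> l \<otimes> m\<parallel> \<le> \<parallel>x \<ominus> l\<parallel> * \<parallel>y\<parallel> + \<parallel>l\<parallel> * \<parallel>y \<ominus> m\<parallel>"
proof -
  have "x \<otimes> y \<ominus> l \<otimes> m = (x \<ominus> l) \<otimes> y \<oplus> l \<otimes> (y \<ominus> m)"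
    using assms by (simp add: mult_diff_left mult_diff_right diff_add_diff)
  moreover have "\<parallel>(x \<ominus> l) \<otimes> y \<oplus> l \<otimes> (y \<ominus> m)\<parallel> \<le> \<parallel>(x \<ominus> l) \<otimes> y\<parallel> + \<parallel>l \<otimes> (y \<ominus> m)\<parallel>"
    using assms by (simp add: norm_triangle)
  moreover have "\<parallel>(x \<ominus> l) \<otimes> y\<parallel> \<le> \<parallel>x \<ominus> l\<parallel> * \<parallel>y\<parallel>" "\<parallel>l \<otimes> (y \<ominus> m)\<parallel> \<le> \<parallel>l\<parallel> * \<parallel>y \<ominus> m\<parallel>"
    using assms by (simp_all add: norm_mult_le)
  ultimately show ?thesis
    by simp
qed

lemma norm_convergent_to_mult:
  assumes "range X \<subseteq> carrier A" "l \<in> carrier A" "range Y \<subseteq> carrier A" "m \<in> carrier A"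
    and "norm_convergent_to A X l" "norm_convergent_to A Y m"
  shows "norm_convergent_to A (\<lambda>n. X n \<otimes> Y n) (l \<otimes> m)"
proof (rule norm_convergent_to_squeeze)
  have X: "X n \<in> carrier A" "Y n \<in> carrier A" for n
    using assms by auto
  show "\<parallel>X n \<otimes> Y n \<ominus> l \<otimes> m\<parallel>
      \<le> \<parallel>X n \<ominus> l\<parallel> * (\<parallel>Y n \<ominus> m\<parallel> + \<parallel>m\<parallel>) + \<parallel>l\<parallel> * \<parallel>Y n \<ominus> m\<parallel>" for n
    using norm_mult_diff_le[of "X n" "Y n" l m] norm_le_norm_diff[of "Y n" m]
      mult_left_mono[of "\<parallel>Y n\<parallel>" "\<parallel>Y n \<ominus> m\<parallel> + \<parallel>m\<parallel>" "\<parallel>X n \<ominus> l\<parallel>"] norm_nonneg[of "X n \<ominus> l"] X assms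
    by simp
  have "(\<lambda>n. \<parallel>X n \<ominus> l\<parallel> * (\<parallel>Y n \<ominus> m\<parallel> + \<parallel>m\<parallel>) + \<parallel>l\<parallel> * \<parallel>Y n \<ominus> m\<parallel>)
      \<longlonglongrightarrow> 0 * (0 + \<parallel>m\<parallel>) + \<parallel>l\<parallel> * 0"
    using assms(5,6) unfolding norm_convergent_to_def by (intro tendsto_intros)
  then show "(\<lambda>n. \<parallel>X n \<ominus> l\<parallel> * (\<parallel>Y n \<ominus> m\<parallel> + \<parallel>m\<parallel>) + \<parallel>l\<parallel> * \<parallel>Y n \<ominus> m\<parallel>) \<longlonglongrightarrow> 0"
    by simp
qed (use assms in \<open>auto simp: image_subset_iff\<close>)

lemma norm_convergent_to_smult:
  assumes "range X \<subseteq> carrier A" "l \<in> carrier A" "norm_convergent_to A X l"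
  shows "norm_convergent_to A (\<lambda>n. c \<odot> X n) (c \<odot> l)"
proof -
  have X: "X n \<in> carrier A" for n
    using assms by auto
  then show ?thesis
    using tendsto_mult_left[OF assms(3)[unfolded norm_convergent_to_def], of "cmod c"] assms
    by (simp add: norm_convergent_to_def norm_smult flip: smult_diff_right)
qed

lemma norm_convergent_to_adj:
  assumes "range X \<subseteq> carrier A" "l \<in> carrier A" "norm_convergent_to A X l"
  shows "norm_convergent_to A (\<lambda>n. adj (X n)) (adj l)"
proof -
  have X: "X n \<in> carrier A" for n
    using assms by auto
  then show ?thesis
    using assms by (simp add: norm_convergent_to_def flip: adj_diff)
qed

end

section \<open>Homomorphisms are contractive\<close>

context cstar_algebra
begin

text \<open>The Cauchy half of Banach's fixed point argument. \<open>P\<close> describes the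
  invariant region and is not assumed to be closed, so the conclusion speaks of the iterates and
  their limit; what passes to the limit is left to the application.\<close>

lemma contraction_fixed_point:
  assumes f: "\<And>x. x \<in> carrier A \<Longrightarrow> P x \<Longrightarrow> f x \<in> carrier A \<and> P (f x)"
    and x0: "x0 \<in> carrier A" "P x0" and r: "0 \<le> r" "r < 1"
    and lip: "\<And>x y. \<lbrakk>x \<in> carrier A; P x; y \<in> carrier A; P y\<rbrakk> \<Longrightarrow> \<parallel>f x \<ominus> f y\<parallel> \<le> r * \<parallel>x \<ominus> y\<parallel>"
    and bdd: "\<And>x. \<lbrakk>x \<in> carrier A; P x\<rbrakk> \<Longrightarrow> \<parallel>x \<ominus> x0\<parallel> \<le> C"
  obtains l where "l \<in> carrier A" "norm_convergent_to A (\<lambda>n. (f ^^ n) x0) l"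
    "\<And>n. (f ^^ n) x0 \<in> carrier A" "\<And>n. P ((f ^^ n) x0)"
proof -
  define s where "s n = (f ^^ n) x0" for n
  have s: "s n \<in> carrier A \<and> P (s n)" for n
    by (induction n) (use f x0 in \<open>auto simp: s_def\<close>)
  have C: "0 \<le> C"
    using bdd[OF x0] x0 by simp
  \<comment> \<open>Both iterates are contracted together, down to a pair containing
    \<open>x0\<close>, whose distance is bounded by \<open>C\<close>. This gives the Cauchy estimate
    without summing a geometric series.\<close>
  have geo: "\<parallel>s (n + k) \<ominus> s n\<parallel> \<le> r ^ n * C" for n k
  proof (induction n)
    case 0
    then show ?case
      using bdd s[of k] by (simp add: s_def)
  next
    case (Suc n)
    have "\<parallel>s (Suc n + k) \<ominus> s (Suc n)\<parallel> \<le> r * \<parallel>s (n + k) \<ominus> s n\<parallel>"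
      using lip[of "s (n + k)" "s n"] s by (simp add: s_def)
    also have "\<dots> \<le> r * (r ^ n * C)"
      using Suc r by (intro mult_left_mono) auto
    finally show ?case
      by (simp add: mult.assoc)
  qed
  have "norm_Cauchy A s"
    unfolding norm_Cauchy_def
  proof (intro allI impI)
    fix e :: real assume "e > 0"
    have "(\<lambda>n. r ^ n * C) \<longlonglongrightarrow> 0 * C"
      using r by (intro tendsto_mult_right LIMSEQ_power_zero) auto
    then have "\<forall>\<^sub>F n in sequentially. r ^ n * C < e"
      using \<open>e > 0\<close> by (auto dest: order_tendstoD)
    then obtain N where N: "\<And>n. n \<ge> N \<Longrightarrow> r ^ n * C < e"
      by (auto simp: eventually_sequentially)
    have le: "\<parallel>s m \<ominus> s n\<parallel> < e" if "N \<le> n" "n \<le> m" for m n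
      using geo[of n "m - n"] N[of n] that by simp
    then have "\<parallel>s m \<ominus> s n\<parallel> < e" if "N \<le> n" "N \<le> m" for m n
      using that norm_diff_commute[of "s m" "s n"] s by (metis nle_le)
    then show "\<exists>N. \<forall>m\<ge>N. \<forall>n\<ge>N. \<parallel>s m \<ominus> s n\<parallel> < e"
      by blast
  qed
  then obtain l where "l \<in> carrier A" "norm_convergent_to A s l"
    using norm_complete[of s] s by blast
  then show thesis
    using that[of l] s unfolding s_def[abs_def] by auto
qed

text \<open>The element \<open>s\<close> is a replacement for \<open>1 - sqrt (1 - h\<^sup>2)\<close>, which avoids both a unit and
  functional calculus: it is the limit of the iterates of \<open>x \<mapsto> (h\<^sup>2 + x\<^sup>2) / 2\<close>, starting at 0.\<close>

lemma exists_commuting_root: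
  assumes h: "h \<in> carrier A" "adj h = h" and h1: "\<parallel>h\<parallel> < 1"
  obtains s where "s \<in> carrier A" "adj s = s" "s \<otimes> h = h \<otimes> s" "h \<otimes> h \<oplus> s \<otimes> s = s \<oplus> s"
proof -
  define f where "f x = (1/2) \<odot> (h \<otimes> h \<oplus> x \<otimes> x)" for x
  \<comment> \<open>The ball of radius \<open>\<parallel>h\<parallel>\<close> is mapped into itself
    because the square of a number in [0, 1) does not exceed it, and on this ball \<open>f\<close>
    has Lipschitz constant \<open>\<parallel>h\<parallel>\<close>, the mean of the bounds for its
    two arguments.\<close>
  define P where "P x \<longleftrightarrow> \<parallel>x\<parallel> \<le> \<parallel>h\<parallel> \<and> adj x = x \<and> x \<otimes> h = h \<otimes> x" for x
  have h0: "0 \<le> \<parallel>h\<parallel>"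
    using h norm_nonneg by blast
  have P_f: "f x \<in> carrier A \<and> P (f x)" if x: "x \<in> carrier A" "P x" for x
  proof -
    have "\<parallel>f x\<parallel> \<le> (\<parallel>h \<otimes> h\<parallel> + \<parallel>x \<otimes> x\<parallel>) / 2"
      using x h norm_triangle[of "h \<otimes> h" "x \<otimes> x"] by (simp add: f_def norm_smult)
    also have "\<dots> \<le> (\<parallel>h\<parallel> * \<parallel>h\<parallel> + \<parallel>x\<parallel> * \<parallel>x\<parallel>) / 2"
      using x h norm_mult_le[of h h] norm_mult_le[of x x] by simp
    also have "\<dots> \<le> (\<parallel>h\<parallel> * 1 + \<parallel>h\<parallel> * 1) / 2"
      using x h h0 h1 norm_nonneg[of x]
      by (intro divide_right_mono add_mono mult_mono) (auto simp: P_def)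
    finally have "\<parallel>f x\<parallel> \<le> \<parallel>h\<parallel>"
      by simp
    moreover have "adj (f x) = f x"
      using x h by (simp add: f_def adj_smult adj_add adj_mult P_def)
    moreover have "x \<otimes> x \<otimes> h = h \<otimes> (x \<otimes> x)"
      using x h by (metis P_def mult_assoc)
    then have "f x \<otimes> h = h \<otimes> f x"
      using x h
      by (simp add: f_def mult_smult_left mult_smult_right mult_add_left mult_add_right mult_assoc)
    ultimately show ?thesis
      using x h by (simp add: f_def P_def)
  qed
  have lip: "\<parallel>f x \<ominus> f y\<parallel> \<le> \<parallel>h\<parallel> * \<parallel>x \<ominus> y\<parallel>"
    if x: "x \<in> carrier A" "P x" and y: "y \<in> carrier A" "P y" for x y
  proof -
    have "f x \<ominus> f y = (1/2) \<odot> (x \<otimes> x \<ominus> y \<otimes> y)"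
      using h x y by (simp add: f_def add_diff_add flip: smult_diff_right)
    then have "\<parallel>f x \<ominus> f y\<parallel> = \<parallel>x \<otimes> x \<ominus> y \<otimes> y\<parallel> / 2"
      using x y by (simp add: norm_smult)
    also have "\<dots> \<le> (\<parallel>x \<ominus> y\<parallel> * \<parallel>x\<parallel> + \<parallel>y\<parallel> * \<parallel>x \<ominus> y\<parallel>) / 2"
      using x y norm_mult_diff_le[of x x y y] by simp
    also have "\<dots> \<le> (\<parallel>x \<ominus> y\<parallel> * \<parallel>h\<parallel> + \<parallel>h\<parallel> * \<parallel>x \<ominus> y\<parallel>) / 2"
      using x y norm_nonneg[of "x \<ominus> y"]
      by (intro divide_right_mono add_mono mult_left_mono mult_right_mono) (auto simp: P_def)
    finally show ?thesis
      by simp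
  qed
  obtain s where s: "s \<in> carrier A" and lim: "norm_convergent_to A (\<lambda>n. (f ^^ n) \<zero>) s"
    and car: "\<And>n. (f ^^ n) \<zero> \<in> carrier A" and P: "\<And>n. P ((f ^^ n) \<zero>)"
    by (rule contraction_fixed_point[where f = f and P = P and ?x0.0 = \<zero> and r = "\<parallel>h\<parallel>" and C = "\<parallel>h\<parallel>"])
      (use P_f lip h h0 h1 in \<open>auto simp: P_def\<close>)
  let ?s = "\<lambda>n. (f ^^ n) \<zero>"
  have ran: "range ?s \<subseteq> carrier A"
    using car by auto
  have "norm_convergent_to A ?s (adj s)"
    using norm_convergent_to_adj[OF ran s lim] P by (simp add: P_def)
  then have "adj s = s"
    using norm_convergent_to_unique[OF ran _ _ _ lim] s by simp
  have h_lim: "norm_convergent_to A (\<lambda>_. h) h"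
    using h by (simp add: norm_convergent_to_def)
  have "norm_convergent_to A (\<lambda>n. h \<otimes> ?s n) (s \<otimes> h)"
    using norm_convergent_to_mult[OF ran s _ _ lim h_lim] h P by (simp add: P_def)
  then have "s \<otimes> h = h \<otimes> s"
    using norm_convergent_to_mult[OF _ _ ran s h_lim lim] h s car
    by (intro norm_convergent_to_unique[of "\<lambda>n. h \<otimes> ?s n"]) auto
  have "norm_convergent_to A (\<lambda>n. ?s n \<otimes> ?s n) (s \<otimes> s)"
    by (intro norm_convergent_to_mult ran s lim)
  moreover have "norm_convergent_to A (\<lambda>n. h \<otimes> h) (h \<otimes> h)"
    using h by (simp add: norm_convergent_to_def)
  ultimately have "norm_convergent_to A (\<lambda>n. (1/2) \<odot> (h \<otimes> h \<oplus> ?s n \<otimes> ?s n))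
      ((1/2) \<odot> (h \<otimes> h \<oplus> s \<otimes> s))"
    using car s h
    by (intro norm_convergent_to_smult norm_convergent_to_add) (auto simp: image_subset_iff)
  then have "norm_convergent_to A (\<lambda>n. f (?s n)) (f s)"
    by (simp flip: f_def)
  \<comment> \<open>Applying \<open>f\<close> only shifts the sequence of iterates, so it has the
    limits \<open>f s\<close> and \<open>s\<close> at once.\<close>
  moreover have "norm_convergent_to A (\<lambda>n. f (?s n)) s"
    using LIMSEQ_Suc[OF lim[unfolded norm_convergent_to_def]] by (simp add: norm_convergent_to_def)
  ultimately have "f s = s"
    using s h car P_f[OF car P]
    by (intro norm_convergent_to_unique[of "\<lambda>n. f (?s n)"]) (auto simp: f_def)
  then have "s \<oplus> s = f s \<oplus> f s"
    by simp
  also have "\<dots> = h \<otimes> h \<oplus> s \<otimes> s"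
    using s h smult_add_left[of "h \<otimes> h \<oplus> s \<otimes> s" "1/2" "1/2"] by (simp add: f_def smult_1)
  finally show thesis
    using that s \<open>adj s = s\<close> \<open>s \<otimes> h = h \<otimes> s\<close> by simp
qed

text \<open>Pythagoras for real and imaginary parts: with \<open>z\<close> equal to \<i> or its
  negative, the mixed terms are multiples of \<open>adj a \<otimes> c\<close> by \<open>z\<close>
  and \<open>- z\<close> and cancel.\<close>

lemma adj_mult_add_imaginary:
  assumes "a \<in> carrier A" "c \<in> carrier A" "adj a \<otimes> c = adj c \<otimes> a" "cnj z = - z" "cmod z = 1"
  shows "adj (a \<oplus> z \<odot> c) \<otimes> (a \<oplus> z \<odot> c) = adj a \<otimes> a \<oplus> adj c \<otimes> c"
proof -
  let ?w = "adj a \<otimes> c"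
  have z: "- (z * z) = 1"
    using complex_norm_square[of z] assms by simp
  have w: "?w \<in> carrier A"
    using assms by simp
  have "(- z) \<odot> ?w \<oplus> z \<odot> ?w = \<zero>"
    using w smult_add_left[of ?w "-z" z] by simp
  moreover have "(adj a \<otimes> a \<oplus> (- z) \<odot> ?w) \<oplus> (z \<odot> ?w \<oplus> adj c \<otimes> c)
      = adj a \<otimes> a \<oplus> (((- z) \<odot> ?w \<oplus> z \<odot> ?w) \<oplus> adj c \<otimes> c)"
    using assms(1,2) w by (simp add: a_assoc)
  ultimately have "(adj a \<otimes> a \<oplus> (- z) \<odot> ?w) \<oplus> (z \<odot> ?w \<oplus> adj c \<otimes> c)
      = adj a \<otimes> a \<oplus> adj c \<otimes> c"
    using assms(2) by simp
  moreover have "adj (a \<oplus> z \<odot> c) \<otimes> (a \<oplus> z \<odot> c)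
      = (adj a \<otimes> a \<oplus> (- z) \<odot> (adj c \<otimes> a)) \<oplus> (z \<odot> ?w \<oplus> (- (z * z)) \<odot> (adj c \<otimes> c))"
    using assms(1,2,4) by (simp add: adj_add adj_smult mult_add_left mult_add_right mult_smult_left
        mult_smult_right smult_smult smult_add_right)
  moreover have "1 \<odot> (adj c \<otimes> c) = adj c \<otimes> c"
    using assms(2) by (simp add: smult_1)
  ultimately show ?thesis
    by (simp only: z flip: assms(3))
qed

text \<open>In a unital algebra, \<open>k\<close> is the real part of the unitary \<open>k + i (1 - t)\<close>.\<close>

lemma norm_le_one_if_root:
  assumes k: "k \<in> carrier A" "adj k = k" and t: "t \<in> carrier A" "adj t = t"
    and comm: "t \<otimes> k = k \<otimes> t" and root: "k \<otimes> k \<oplus> t \<otimes> t = t \<oplus> t"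
  shows "\<parallel>k\<parallel> \<le> 1"
proof -
  \<comment> \<open>These are the two parts of \<open>k\<close> times the unitary mentioned above:
    formally, k (k + i (1 - t)) = a + i c. The product lies in the algebra although the unitary need
    not, and multiplication by a unitary preserves the norm, which is what \<open>iso\<close>
    verifies.\<close>
  define a where "a = k \<otimes> k"
  define c where "c = k \<ominus> t \<otimes> k"
  have ac: "a \<in> carrier A" "c \<in> carrier A"
    using k t by (auto simp: a_def c_def)
  have adj_a: "adj a = a"
    using k by (simp add: a_def adj_mult)
  have adj_c: "adj c = k \<ominus> k \<otimes> t"
    using k t by (simp add: c_def adj_diff adj_mult)
  have "a \<otimes> c = adj c \<otimes> a"
    using k t comm unfolding a_def adj_c
    by (simp add: c_def mult_diff_left mult_diff_right) (metis mult_assoc mult_closed)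
  then have *: "adj a \<otimes> c = adj c \<otimes> a"
    by (simp add: adj_a)
  have ktk: "k \<otimes> t \<otimes> k \<in> carrier A" "k \<otimes> (t \<otimes> t) \<otimes> k \<in> carrier A"
    using k t by auto
  have "k \<otimes> (k \<otimes> k \<oplus> t \<otimes> t) \<otimes> k = k \<otimes> (t \<oplus> t) \<otimes> k"
    using root by simp
  then have e1: "a \<otimes> a \<oplus> k \<otimes> (t \<otimes> t) \<otimes> k = k \<otimes> t \<otimes> k \<oplus> k \<otimes> t \<otimes> k"
    using k t by (simp add: mult_add_left mult_add_right a_def mult_assoc)
  have "adj c \<otimes> c = (k \<otimes> k \<ominus> k \<otimes> t \<otimes> k) \<ominus> (k \<otimes> t \<otimes> k \<ominus> k \<otimes> (t \<otimes> t) \<otimes> k)"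
    using k t unfolding adj_c by (simp add: c_def mult_diff_left mult_diff_right mult_assoc)
  also have "\<dots> = (k \<otimes> k \<oplus> k \<otimes> (t \<otimes> t) \<otimes> k) \<ominus> (k \<otimes> t \<otimes> k \<oplus> k \<otimes> t \<otimes> k)"
    using k ktk by (simp add: a_minus_def minus_add a_ac minus_minus)
  also have "\<dots> = k \<otimes> k \<ominus> a \<otimes> a"
    unfolding e1[symmetric] using k ac ktk by (simp add: add_diff_add)
  finally have sum: "adj a \<otimes> a \<oplus> adj c \<otimes> c = adj k \<otimes> k"
    using k ac by (simp add: adj_a add_diff_cancel)
  have iso: "\<parallel>a \<oplus> z \<odot> c\<parallel> = \<parallel>k\<parallel>" if "z \<in> {\<i>, -\<i>}" for z
  proof -
    have "adj (a \<oplus> z \<odot> c) \<otimes> (a \<oplus> z \<odot> c) = adj k \<otimes> k"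
      using adj_mult_add_imaginary[OF ac *, of z] sum that by auto
    then have "\<parallel>a \<oplus> z \<odot> c\<parallel>\<^sup>2 = \<parallel>k\<parallel>\<^sup>2"
      using norm_adj_mult[of "a \<oplus> z \<odot> c"] norm_adj_mult[of k] ac k by simp
    then show ?thesis
      using norm_nonneg[of "a \<oplus> z \<odot> c"] norm_nonneg[of k] ac k by simp
  qed
  \<comment> \<open>Adding the versions for \<i> and its negative leaves \<open>2 \<odot> a\<close>.
    Hence twice the square of the norm of \<open>k\<close> is at most twice the norm.\<close>
  have "\<i> \<odot> c \<oplus> (-\<i>) \<odot> c = \<zero>"
    using ac smult_add_left[of c \<i> "-\<i>"] by simp
  then have "(a \<oplus> \<i> \<odot> c) \<oplus> (a \<oplus> (-\<i>) \<odot> c) = a \<oplus> a"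
    using ac by (simp add: a_ac)
  also have "\<dots> = 2 \<odot> a"
    using ac smult_add_left[of a 1 1] by (simp add: smult_1)
  finally have "\<parallel>2 \<odot> a\<parallel> \<le> \<parallel>k\<parallel> + \<parallel>k\<parallel>"
    using norm_triangle[of "a \<oplus> \<i> \<odot> c" "a \<oplus> (-\<i>) \<odot> c"] iso ac by simp
  then have "\<parallel>k\<parallel>\<^sup>2 \<le> \<parallel>k\<parallel>"
    using norm_adj_mult[of k] k ac by (simp add: a_def norm_smult)
  then show ?thesis
    using norm_nonneg[of k] k by (cases "\<parallel>k\<parallel> = 0") (auto simp: power2_eq_square)
qed

end

lemma star_homD:
  assumes "star_hom A B \<phi>"
  shows "x \<in> carrier A \<Longrightarrow> \<phi> x \<in> carrier B"
    and "\<lbrakk>x \<in> carrier A; y \<in> carrier A\<rbrakk> \<Longrightarrow> \<phi> (x \<oplus>\<^bsub>A\<^esub> y) = \<phi> x \<oplus>\<^bsub>B\<^esub> \<phi> y"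
    and "\<lbrakk>x \<in> carrier A; y \<in> carrier A\<rbrakk> \<Longrightarrow> \<phi> (x \<otimes>\<^bsub>A\<^esub> y) = \<phi> x \<otimes>\<^bsub>B\<^esub> \<phi> y"
    and "x \<in> carrier A \<Longrightarrow> \<phi> (c \<odot>\<^bsub>A\<^esub> x) = c \<odot>\<^bsub>B\<^esub> \<phi> x"
    and "x \<in> carrier A \<Longrightarrow> \<phi> (adj\<^bsub>A\<^esub> x) = adj\<^bsub>B\<^esub> (\<phi> x)"
  using assms by (auto simp: star_hom_def)

locale cstar_hom = dom: cstar_algebra A + cod: cstar_algebra B
  for A :: "'a cstar" and B :: "'b cstar" and \<phi> +
  assumes star_hom: "star_hom A B \<phi>"
begin

lemmas hom_simps [simp] = star_homD[OF star_hom]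

lemma hom_zero [simp]: "\<phi> \<zero>\<^bsub>A\<^esub> = \<zero>\<^bsub>B\<^esub>"
  using hom_simps(4)[of "\<zero>\<^bsub>A\<^esub>" 0] by (simp del: hom_simps(4))

lemma hom_diff [simp]:
  "\<lbrakk>x \<in> carrier A; y \<in> carrier A\<rbrakk> \<Longrightarrow> \<phi> (x \<ominus>\<^bsub>A\<^esub> y) = \<phi> x \<ominus>\<^bsub>B\<^esub> \<phi> y"
  by (simp add: a_minus_def dom.a_inv_eq_smult cod.a_inv_eq_smult)

text \<open>After scaling, \<open>h\<close> has a companion from
  \<open>exists_commuting_root\<close>. The equations that the companion satisfies are purely
  algebraic, so they hold for the images too and bound the norm in the codomain by
  \<open>norm_le_one_if_root\<close>.\<close>

lemma norm_hom_self_adjoint_le: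
  assumes h: "h \<in> carrier A" "adj\<^bsub>A\<^esub> h = h"
  shows "\<parallel>\<phi> h\<parallel>\<^bsub>B\<^esub> \<le> \<parallel>h\<parallel>\<^bsub>A\<^esub>"
proof (rule field_le_epsilon)
  fix e :: real assume e: "e > 0"
  \<comment> \<open>The extra \<open>e\<close> makes the norm of \<open>g\<close> strictly less than
    1 and also covers the case that \<open>h\<close> is zero.\<close>
  define d where "d = \<parallel>h\<parallel>\<^bsub>A\<^esub> + e"
  have d: "d > 0" "\<parallel>h\<parallel>\<^bsub>A\<^esub> < d"
    using e dom.norm_nonneg h by (auto simp: d_def add_nonneg_pos)
  define g where "g = complex_of_real (1 / d) \<odot>\<^bsub>A\<^esub> h"
  have g: "g \<in> carrier A" "adj\<^bsub>A\<^esub> g = g" "\<parallel>g\<parallel>\<^bsub>A\<^esub> < 1"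
    using h d by (auto simp: g_def dom.adj_smult dom.norm_smult norm_divide)
  obtain s where s: "s \<in> carrier A" "adj\<^bsub>A\<^esub> s = s" "s \<otimes>\<^bsub>A\<^esub> g = g \<otimes>\<^bsub>A\<^esub> s"
    "g \<otimes>\<^bsub>A\<^esub> g \<oplus>\<^bsub>A\<^esub> s \<otimes>\<^bsub>A\<^esub> s = s \<oplus>\<^bsub>A\<^esub> s"
    using dom.exists_commuting_root[OF g] by blast
  have "\<parallel>\<phi> g\<parallel>\<^bsub>B\<^esub> \<le> 1"
  proof (rule cod.norm_le_one_if_root)
    show "adj\<^bsub>B\<^esub> \<phi> g = \<phi> g" "adj\<^bsub>B\<^esub> \<phi> s = \<phi> s"
      using g s by (metis hom_simps(5))+
    show "\<phi> s \<otimes>\<^bsub>B\<^esub> \<phi> g = \<phi> g \<otimes>\<^bsub>B\<^esub> \<phi> s"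
      using g s by (metis hom_simps(3))
    show "\<phi> g \<otimes>\<^bsub>B\<^esub> \<phi> g \<oplus>\<^bsub>B\<^esub> \<phi> s \<otimes>\<^bsub>B\<^esub> \<phi> s = \<phi> s \<oplus>\<^bsub>B\<^esub> \<phi> s"
      using arg_cong[OF s(4), of \<phi>] g s(1) by simp
  qed (use g s in auto)
  then show "\<parallel>\<phi> h\<parallel>\<^bsub>B\<^esub> \<le> \<parallel>h\<parallel>\<^bsub>A\<^esub> + e"
    using d h by (simp add: g_def cod.norm_smult norm_divide field_simps) (simp add: d_def)
qed

text \<open>The C*-identity on both sides reduces the claim to the self-adjoint element
  \<open>adj x \<otimes> x\<close>.\<close>

lemma norm_hom_le:
  assumes x: "x \<in> carrier A"
  shows "\<parallel>\<phi> x\<parallel>\<^bsub>B\<^esub> \<le> \<parallel>x\<parallel>\<^bsub>A\<^esub>"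
proof (rule power2_le_imp_le)
  have "(\<parallel>\<phi> x\<parallel>\<^bsub>B\<^esub>)\<^sup>2 = \<parallel>\<phi> (adj\<^bsub>A\<^esub> x \<otimes>\<^bsub>A\<^esub> x)\<parallel>\<^bsub>B\<^esub>"
    using x cod.norm_adj_mult by simp
  also have "\<dots> \<le> \<parallel>adj\<^bsub>A\<^esub> x \<otimes>\<^bsub>A\<^esub> x\<parallel>\<^bsub>A\<^esub>"
    using x by (intro norm_hom_self_adjoint_le) (auto simp: dom.adj_mult)
  finally show "(\<parallel>\<phi> x\<parallel>\<^bsub>B\<^esub>)\<^sup>2 \<le> (\<parallel>x\<parallel>\<^bsub>A\<^esub>)\<^sup>2"
    using x dom.norm_adj_mult by simp
qed (use x dom.norm_nonneg in auto)

end

section \<open>Closed subalgebras and generating sets\<close>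

lemma closed_star_subalgebraI:
  assumes "B \<subseteq> carrier A" "\<zero>\<^bsub>A\<^esub> \<in> B"
    and "\<And>x y. \<lbrakk>x \<in> B; y \<in> B\<rbrakk> \<Longrightarrow> x \<oplus>\<^bsub>A\<^esub> y \<in> B" "\<And>x y. \<lbrakk>x \<in> B; y \<in> B\<rbrakk> \<Longrightarrow> x \<otimes>\<^bsub>A\<^esub> y \<in> B"
    and "\<And>c x. x \<in> B \<Longrightarrow> c \<odot>\<^bsub>A\<^esub> x \<in> B" "\<And>x. x \<in> B \<Longrightarrow> adj\<^bsub>A\<^esub> x \<in> B"
    and "\<And>l X. \<lbrakk>l \<in> carrier A; range X \<subseteq> B; norm_convergent_to A X l\<rbrakk> \<Longrightarrow> l \<in> B"
  shows "closed_star_subalgebra A B"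
  unfolding closed_star_subalgebra_def by (intro conjI ballI allI impI; (elim conjE)?; rule assms; assumption)

lemma closed_star_subalgebraD:
  assumes "closed_star_subalgebra A B"
  shows "\<lbrakk>x \<in> B; y \<in> B\<rbrakk> \<Longrightarrow> x \<otimes>\<^bsub>A\<^esub> y \<in> B" "x \<in> B \<Longrightarrow> adj\<^bsub>A\<^esub> x \<in> B"
  using assms by (simp_all add: closed_star_subalgebra_def)

lemma generates_cstarD:
  "\<lbrakk>generates_cstar A X; closed_star_subalgebra A B; X \<subseteq> B\<rbrakk> \<Longrightarrow> B = carrier A"
  by (auto simp: generates_cstar_def)

lemma generates_cstarI:
  assumes "generates_cstar A X" "Y \<subseteq> carrier A"
    and "\<And>B. \<lbrakk>closed_star_subalgebra A B; Y \<subseteq> B\<rbrakk> \<Longrightarrow> X \<subseteq> B"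
  shows "generates_cstar A Y"
  unfolding generates_cstar_def
proof (intro conjI allI impI assms(2); elim conjE)
  fix B assume "closed_star_subalgebra A B" "Y \<subseteq> B"
  then show "B = carrier A"
    using generates_cstarD[OF assms(1)] assms(3) by simp
qed

text \<open>Fixed points of an endomorphism form a closed subalgebra because homomorphisms are contractive.\<close>

lemma star_hom_eq_id_if_fixes_generators:
  assumes "cstar_algebra A" "star_hom A A \<phi>" "generates_cstar A X" "\<And>x. x \<in> X \<Longrightarrow> \<phi> x = x"
    and "x \<in> carrier A"
  shows "\<phi> x = x"
proof -
  interpret cstar_hom A A \<phi>
    using assms by (simp add: cstar_hom_def cstar_hom_axioms_def)
  let ?B = "{x \<in> carrier A. \<phi> x = x}"
  have "l \<in> ?B" if "l \<in> carrier A" "range Y \<subseteq> ?B" "norm_convergent_to A Y l" for l Y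
  proof -
    have Y: "Y n \<in> carrier A" "\<phi> (Y n) = Y n" for n
      using that by auto
    have "norm_convergent_to A Y (\<phi> l)"
    proof (rule dom.norm_convergent_to_squeeze)
      show "\<parallel>Y n \<ominus>\<^bsub>A\<^esub> \<phi> l\<parallel>\<^bsub>A\<^esub> \<le> \<parallel>Y n \<ominus>\<^bsub>A\<^esub> l\<parallel>\<^bsub>A\<^esub>" for n
        using norm_hom_le[of "Y n \<ominus>\<^bsub>A\<^esub> l"] Y that by simp
      show "(\<lambda>n. \<parallel>Y n \<ominus>\<^bsub>A\<^esub> l\<parallel>\<^bsub>A\<^esub>) \<longlonglongrightarrow> 0"
        using that by (simp add: norm_convergent_to_def)
    qed (use Y that in auto)
    then show ?thesis
      using dom.norm_convergent_to_unique[of Y "\<phi> l" l] Y that by auto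
  qed
  then have "closed_star_subalgebra A ?B"
    by (auto simp: closed_star_subalgebra_def)
  moreover have "X \<subseteq> ?B"
    using assms by (auto simp: generates_cstar_def)
  ultimately have "?B = carrier A"
    using assms(3) unfolding generates_cstar_def by blast
  then show ?thesis
    using assms by blast
qed

section \<open>Countably generated C*-algebras\<close>

lemma less_half_if_less_divide:
  fixes a c e :: real
  assumes "a < e / (2 * c)" "0 < c"
  shows "a * c < e / 2" "c * a < e / 2"
  using assms by (simp_all add: pos_less_divide_eq algebra_simps)

context cstar_algebra
begin

text \<open>A countable \<open>D\<close> cannot be closed under all complex scalars unless it is
  trivial, so closure is required only for a dense set \<open>Q\<close> of them. The norm closure of
  \<open>D\<close> nevertheless admits every scalar, as the operations are continuous.\<close>

lemma closure_closed_star_subalgebra: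
  assumes D: "D \<subseteq> carrier A" "\<zero> \<in> D"
    and Q: "\<And>c e. e > 0 \<Longrightarrow> \<exists>q \<in> Q. cmod (c - q) < e"
    and closed: "\<And>x y. \<lbrakk>x \<in> D; y \<in> D\<rbrakk> \<Longrightarrow> x \<oplus> y \<in> D" "\<And>x y. \<lbrakk>x \<in> D; y \<in> D\<rbrakk> \<Longrightarrow> x \<otimes> y \<in> D"
      "\<And>x. x \<in> D \<Longrightarrow> adj x \<in> D" "\<And>q x. \<lbrakk>q \<in> Q; x \<in> D\<rbrakk> \<Longrightarrow> q \<odot> x \<in> D"
  shows "closed_star_subalgebra A {x \<in> carrier A. \<forall>e>0. \<exists>d\<in>D. \<parallel>x \<ominus> d\<parallel> < e}"
    (is "closed_star_subalgebra A ?K")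
proof -
  have D': "d \<in> carrier A" if "d \<in> D" for d
    using D that by auto
  have K: "x \<in> carrier A" if "x \<in> ?K" for x
    using that by simp
  have add: "x \<oplus> y \<in> ?K" if x: "x \<in> ?K" and y: "y \<in> ?K" for x y
  proof -
    have "\<exists>d\<in>D. \<parallel>x \<oplus> y \<ominus> d\<parallel> < e" if e: "e > 0" for e
    proof -
      have "\<exists>d\<in>D. \<parallel>x \<ominus> d\<parallel> < e / 2" "\<exists>d\<in>D. \<parallel>y \<ominus> d\<parallel> < e / 2"
        using x y e half_gt_zero[OF e] by blast+
      then obtain a b where ab: "a \<in> D" "b \<in> D" "\<parallel>x \<ominus> a\<parallel> < e / 2" "\<parallel>y \<ominus> b\<parallel> < e / 2"
        by blast
      then have "\<parallel>x \<oplus> y \<ominus> (a \<oplus> b)\<parallel> \<le> \<parallel>x \<ominus> a\<parallel> + \<parallel>y \<ominus> b\<parallel>"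
        using K[OF x] K[OF y] D' by (simp add: add_diff_add norm_triangle)
      then have "\<parallel>x \<oplus> y \<ominus> (a \<oplus> b)\<parallel> < e"
        using ab by simp
      then show ?thesis
        using closed(1)[OF ab(1,2)] by blast
    qed
    then show ?thesis
      using K[OF x] K[OF y] by simp
  qed
  have mult: "x \<otimes> y \<in> ?K" if x: "x \<in> ?K" and y: "y \<in> ?K" for x y
  proof -
    have "\<exists>d\<in>D. \<parallel>x \<otimes> y \<ominus> d\<parallel> < e" if e: "e > 0" for e
    proof -
      have nn: "0 \<le> \<parallel>x\<parallel>" "0 \<le> \<parallel>y\<parallel>"
        using K[OF x] K[OF y] norm_nonneg by blast+
      \<comment> \<open>The cap 1 bounds the norm of the approximant \<open>b\<close> by
        \<open>\<parallel>y\<parallel> + 1\<close> before \<open>a\<close> is chosen; adding 1 to a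
        norm in a denominator avoids division by zero.\<close>
      define d where "d = min 1 (e / (2 * (\<parallel>x\<parallel> + 1)))"
      have d: "d > 0"
        using nn e by (simp add: d_def)
      obtain b where b: "b \<in> D" "\<parallel>y \<ominus> b\<parallel> < d"
        using y d by blast
      have "e / (2 * (\<parallel>y\<parallel> + 1)) > 0"
        using nn e by simp
      then obtain a where a: "a \<in> D" "\<parallel>x \<ominus> a\<parallel> < e / (2 * (\<parallel>y\<parallel> + 1))"
        using x by blast
      have ab: "0 \<le> \<parallel>x \<ominus> a\<parallel>" "0 \<le> \<parallel>y \<ominus> b\<parallel>" "0 \<le> \<parallel>b\<parallel>"
        using K[OF x] K[OF y] D'[OF a(1)] D'[OF b(1)] norm_nonneg by simp_all
      have "\<parallel>b\<parallel> \<le> \<parallel>y\<parallel> + 1"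
        using norm_le_norm_diff[of b y] norm_diff_commute[of b y] b K[OF y] D'[OF b(1)] by (simp add: d_def)
      then have "\<parallel>x \<ominus> a\<parallel> * \<parallel>b\<parallel> \<le> \<parallel>x \<ominus> a\<parallel> * (\<parallel>y\<parallel> + 1)"
        using ab by (intro mult_left_mono) auto
      moreover have "\<parallel>x \<ominus> a\<parallel> * (\<parallel>y\<parallel> + 1) < e / 2"
        using a nn by (intro less_half_if_less_divide) auto
      ultimately have 1: "\<parallel>x \<ominus> a\<parallel> * \<parallel>b\<parallel> < e / 2"
        by linarith
      have "\<parallel>x\<parallel> * \<parallel>y \<ominus> b\<parallel> \<le> (\<parallel>x\<parallel> + 1) * \<parallel>y \<ominus> b\<parallel>"
        using ab by (intro mult_right_mono) auto
      moreover have "(\<parallel>x\<parallel> + 1) * \<parallel>y \<ominus> b\<parallel> < e / 2"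
        using b nn by (intro less_half_if_less_divide) (auto simp: d_def)
      ultimately have 2: "\<parallel>x\<parallel> * \<parallel>y \<ominus> b\<parallel> < e / 2"
        by linarith
      have "\<parallel>x \<otimes> y \<ominus> a \<otimes> b\<parallel> = \<parallel>a \<otimes> b \<ominus> x \<otimes> y\<parallel>"
        using K[OF x] K[OF y] D'[OF a(1)] D'[OF b(1)] by (intro norm_diff_commute) auto
      also have "\<dots> \<le> \<parallel>a \<ominus> x\<parallel> * \<parallel>b\<parallel> + \<parallel>x\<parallel> * \<parallel>b \<ominus> y\<parallel>"
        using K[OF x] K[OF y] D'[OF a(1)] D'[OF b(1)] by (intro norm_mult_diff_le) auto
      also have "\<dots> = \<parallel>x \<ominus> a\<parallel> * \<parallel>b\<parallel> + \<parallel>x\<parallel> * \<parallel>y \<ominus> b\<parallel>"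
        using K[OF x] K[OF y] D'[OF a(1)] D'[OF b(1)] norm_diff_commute[of a x] norm_diff_commute[of b y] by simp
      also have "\<dots> < e"
        using 1 2 by simp
      finally show ?thesis
        using closed(2)[OF a(1) b(1)] by blast
    qed
    then show ?thesis
      using K[OF x] K[OF y] by simp
  qed
  have smult: "c \<odot> x \<in> ?K" if x: "x \<in> ?K" for c x
  proof -
    have "\<exists>d\<in>D. \<parallel>c \<odot> x \<ominus> d\<parallel> < e" if e: "e > 0" for e
    proof -
      have nn: "0 \<le> \<parallel>x\<parallel>"
        using K[OF x] norm_nonneg by blast
      \<comment> \<open>The scalar is approximated before the vector, since the precision needed for
        \<open>d\<close> depends on \<open>q\<close>.\<close>
      obtain q where q: "q \<in> Q" "cmod (c - q) < e / (2 * (\<parallel>x\<parallel> + 1))"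
        using Q[of "e / (2 * (\<parallel>x\<parallel> + 1))" c] nn e by (auto simp: add_nonneg_pos)
      have "e / (2 * (cmod q + 1)) > 0"
        using e by (simp add: add_nonneg_pos)
      then obtain d where d: "d \<in> D" "\<parallel>x \<ominus> d\<parallel> < e / (2 * (cmod q + 1))"
        using x by blast
      have "cmod (c - q) * \<parallel>x\<parallel> \<le> cmod (c - q) * (\<parallel>x\<parallel> + 1)"
        by (intro mult_left_mono) auto
      also have "\<dots> < e / 2"
        using q nn by (intro less_half_if_less_divide) auto
      finally have 1: "\<parallel>c \<odot> x \<ominus> q \<odot> x\<parallel> < e / 2"
        using K[OF x] by (simp add: norm_smult flip: smult_diff_left)
      have "cmod q * \<parallel>x \<ominus> d\<parallel> \<le> (cmod q + 1) * \<parallel>x \<ominus> d\<parallel>"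
        using K[OF x] D'[OF d(1)] norm_nonneg[of "x \<ominus> d"]
        by (intro mult_right_mono) auto
      also have "\<dots> < e / 2"
        using d(2) by (intro less_half_if_less_divide) (auto simp: add_nonneg_pos)
      finally have 2: "\<parallel>q \<odot> x \<ominus> q \<odot> d\<parallel> < e / 2"
        using K[OF x] D'[OF d(1)] by (simp add: norm_smult flip: smult_diff_right)
      have "\<parallel>c \<odot> x \<ominus> q \<odot> d\<parallel> < e"
        using norm_diff_triangle[of "c \<odot> x" "q \<odot> d" "q \<odot> x"] 1 2 K[OF x] D'[OF d(1)] by simp
      then show ?thesis
        using closed(4)[OF q(1) d(1)] by blast
    qed
    then show ?thesis
      using K[OF x] by simp
  qed
  have adj: "adj x \<in> ?K" if x: "x \<in> ?K" for x
  proof -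
    have "\<exists>d\<in>D. \<parallel>adj x \<ominus> d\<parallel> < e" if e: "e > 0" for e
    proof -
      obtain d where d: "d \<in> D" "\<parallel>x \<ominus> d\<parallel> < e"
        using x e by blast
      then have "\<parallel>adj x \<ominus> adj d\<parallel> < e"
        using K[OF x] D' by (simp flip: adj_diff)
      then show ?thesis
        using closed(3)[OF d(1)] by blast
    qed
    then show ?thesis
      using K[OF x] by simp
  qed
  have lim: "l \<in> ?K" if l: "l \<in> carrier A" and X: "range X \<subseteq> ?K" "norm_convergent_to A X l" for l X
  proof -
    have X': "X n \<in> ?K" for n
      using X(1) by blast
    have "\<exists>d\<in>D. \<parallel>l \<ominus> d\<parallel> < e" if e: "e > 0" for e
    proof -
      have "\<forall>\<^sub>F n in sequentially. \<parallel>X n \<ominus> l\<parallel> < e / 2"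
        using order_tendstoD(2)[OF X(2)[unfolded norm_convergent_to_def], of "e / 2"] e by simp
      then obtain n where n: "\<parallel>X n \<ominus> l\<parallel> < e / 2"
        by (auto simp: eventually_sequentially)
      obtain d where d: "d \<in> D" "\<parallel>X n \<ominus> d\<parallel> < e / 2"
        using X'[of n] half_gt_zero[OF e] by blast
      have "\<parallel>l \<ominus> d\<parallel> < e"
        using norm_diff_triangle[of l d "X n"] norm_diff_commute[of l "X n"]
          n d(2) l K[OF X'[of n]] D'[OF d(1)] by simp
      then show ?thesis
        using d by blast
    qed
    then show ?thesis
      using l by simp
  qed
  have zero: "\<zero> \<in> ?K"
    using D norm_zero by (auto intro!: bexI[of _ \<zero>])
  show ?thesis
    by (rule closed_star_subalgebraI[OF _ zero add mult smult adj lim]) simp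
qed

text \<open>The union of the stages contains \<open>X\<close> and is closed under the operations
  with scalars from \<open>Q\<close>. Building it in stages makes countability a plain induction,
  and two elements always lie in a common stage because the stages increase.\<close>

primrec dense_stage :: "complex set \<Rightarrow> 'a set \<Rightarrow> nat \<Rightarrow> 'a set" where
  "dense_stage Q X 0 = insert \<zero> X"
| "dense_stage Q X (Suc n) = dense_stage Q X n
    \<union> (\<lambda>(x, y). x \<oplus> y) ` (dense_stage Q X n \<times> dense_stage Q X n)
    \<union> (\<lambda>(x, y). x \<otimes> y) ` (dense_stage Q X n \<times> dense_stage Q X n)
    \<union> (\<lambda>x. adj x) ` dense_stage Q X n
    \<union> (\<lambda>(q, x). q \<odot> x) ` (Q \<times> dense_stage Q X n)"

lemma countable_dense_stage:
  "\<lbrakk>countable Q; countable X\<rbrakk> \<Longrightarrow> countable (dense_stage Q X n)"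
  by (induction n) auto

lemma dense_stage_subset_carrier:
  assumes "X \<subseteq> carrier A"
  shows "dense_stage Q X n \<subseteq> carrier A"
proof (induction n)
  case 0
  then show ?case
    using assms by simp
next
  case (Suc n)
  then show ?case
    by (auto simp: subset_iff)
qed

text \<open>The stages provide a countable dense set. An element is determined by which of its
  members are how close, which is a set of pairs of natural numbers, and there are only continuum
  many such sets.\<close>

lemma inj_into_real_if_countably_generated:
  assumes "countable X" "generates_cstar A X"
  shows "\<exists>g :: 'a \<Rightarrow> real. inj_on g (carrier A)"
proof -
  obtain Q :: "complex set" where Q: "countable Q" "\<And>U. open U \<Longrightarrow> U \<noteq> {} \<Longrightarrow> \<exists>q\<in>Q. q \<in> U"
    by (rule countable_dense_setE) blast
  have Q': "\<exists>q\<in>Q. cmod (c - q) < e" if "e > 0" for c e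
    using Q(2)[of "ball c e"] that by (auto simp: dist_norm)
  define D where "D = (\<Union>n. dense_stage Q X n)"
  have mono: "dense_stage Q X m \<subseteq> dense_stage Q X n" if "m \<le> n" for m n
    by (rule lift_Suc_mono_le[of "dense_stage Q X", OF _ that]) auto
  have two: "\<exists>n. x \<in> dense_stage Q X n \<and> y \<in> dense_stage Q X n" if "x \<in> D" "y \<in> D" for x y
    using that mono[OF max.cobounded1] mono[OF max.cobounded2] unfolding D_def by blast
  have X: "X \<subseteq> carrier A"
    using assms by (simp add: generates_cstar_def)
  then have D: "D \<subseteq> carrier A"
    using dense_stage_subset_carrier unfolding D_def by blast
  let ?K = "{x \<in> carrier A. \<forall>e>0. \<exists>d\<in>D. \<parallel>x \<ominus> d\<parallel> < e}"
  have "closed_star_subalgebra A ?K"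
  proof (rule closure_closed_star_subalgebra[where Q = Q])
    have "\<zero> \<in> dense_stage Q X 0"
      by simp
    then show "\<zero> \<in> D"
      unfolding D_def by blast
    fix x y assume "x \<in> D" "y \<in> D"
    then obtain n where "x \<in> dense_stage Q X n" "y \<in> dense_stage Q X n"
      using two by blast
    then have "x \<oplus> y \<in> dense_stage Q X (Suc n)" "x \<otimes> y \<in> dense_stage Q X (Suc n)"
      by force+
    then show "x \<oplus> y \<in> D" "x \<otimes> y \<in> D"
      unfolding D_def by blast+
  next
    fix x assume "x \<in> D"
    then obtain n where "x \<in> dense_stage Q X n"
      unfolding D_def by blast
    then have "adj x \<in> dense_stage Q X (Suc n)" "\<And>q. q \<in> Q \<Longrightarrow> q \<odot> x \<in> dense_stage Q X (Suc n)"
      by force+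
    then show "adj x \<in> D" "\<And>q. q \<in> Q \<Longrightarrow> q \<odot> x \<in> D"
      unfolding D_def by blast+
  qed (use D Q' in auto)
  moreover have "X \<subseteq> ?K"
  proof
    fix x assume x: "x \<in> X"
    then have "x \<in> dense_stage Q X 0"
      by simp
    then have "x \<in> D"
      unfolding D_def by blast
    then show "x \<in> ?K"
      using X x by (auto intro!: bexI[of _ x])
  qed
  ultimately have K: "?K = carrier A"
    by (rule generates_cstarD[OF assms(2)])
  have "countable D"
    using countable_dense_stage Q assms by (auto simp: D_def)
  moreover have "D \<noteq> {}"
    using K zero_closed zero_less_one by blast
  ultimately obtain d :: "nat \<Rightarrow> 'a" where d: "range d = D"
    by (metis uncountable_def)
  \<comment> \<open>This code determines \<open>x\<close>: by density some \<open>d n\<close> is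
    arbitrarily close to \<open>x\<close>, and an element with the same code is equally close to
    that \<open>d n\<close>.\<close>
  define h where "h x = prod_encode ` {(n, m). \<parallel>x \<ominus> d n\<parallel> < 1 / real (Suc m)}" for x
  have "inj_on h (carrier A)"
  proof (rule inj_onI)
    fix x y assume x: "x \<in> carrier A" and y: "y \<in> carrier A" and "h x = h y"
    then have eq: "{(n, m). \<parallel>x \<ominus> d n\<parallel> < 1 / real (Suc m)} = {(n, m). \<parallel>y \<ominus> d n\<parallel> < 1 / real (Suc m)}"
      using inj_prod_encode[of UNIV] by (simp add: h_def inj_image_eq_iff)
    show "x = y"
    proof (rule eq_if_norm_diff_less[OF x y])
      fix e :: real assume "e > 0"
      then obtain m where m: "1 / real (Suc m) < e / 2"
        using nat_approx_posE[of "e / 2"] half_gt_zero by blast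
      have "x \<in> ?K"
        by (simp only: K x)
      moreover have "0 < 1 / real (Suc m)"
        by simp
      ultimately have "\<exists>z\<in>D. \<parallel>x \<ominus> z\<parallel> < 1 / real (Suc m)"
        by blast
      then obtain n where n: "\<parallel>x \<ominus> d n\<parallel> < 1 / real (Suc m)"
        using d by blast
      then have "\<parallel>y \<ominus> d n\<parallel> < 1 / real (Suc m)"
        using eq by blast
      moreover have "d n \<in> carrier A"
        using d D by blast
      ultimately show "\<parallel>x \<ominus> y\<parallel> < e"
        using norm_diff_triangle[OF x y, of "d n"] norm_diff_commute[OF y, of "d n"] n m by linarith
    qed
  qed
  moreover obtain g :: "nat set \<Rightarrow> real" where "inj g"
    using eqpoll_imp_lepoll[OF nat_sets_eqpoll_reals] by (auto simp: lepoll_def)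
  ultimately have "inj_on (g \<circ> h) (carrier A)"
    by (intro comp_inj_on) (auto intro: inj_on_subset)
  then show ?thesis
    by blast
qed

end

text \<open>Transport of structure along a map that is injective on the carrier. It produces the
  real copies to which the universal property can be applied.\<close>

definition cstar_image :: "('a \<Rightarrow> 'b) \<Rightarrow> 'a cstar \<Rightarrow> 'b cstar" where
  "cstar_image g A = (let h = inv_into (carrier A) g in
    cstar.make (g ` carrier A) (\<lambda>x y. g (h x \<otimes>\<^bsub>A\<^esub> h y)) (g \<one>\<^bsub>A\<^esub>) (g \<zero>\<^bsub>A\<^esub>)
      (\<lambda>x y. g (h x \<oplus>\<^bsub>A\<^esub> h y)) (\<lambda>c x. g (c \<odot>\<^bsub>A\<^esub> h x)) (\<lambda>x. g (adj\<^bsub>A\<^esub> (h x)))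
      (\<lambda>x. \<parallel>h x\<parallel>\<^bsub>A\<^esub>))"

context cstar_algebra
begin

context
  fixes g :: "'a \<Rightarrow> 'b"
  assumes inj: "inj_on g (carrier A)"
begin

lemma cstar_image_simps [simp]:
  "carrier (cstar_image g A) = g ` carrier A"
  "\<zero>\<^bsub>cstar_image g A\<^esub> = g \<zero>"
  "\<lbrakk>x \<in> carrier A; y \<in> carrier A\<rbrakk> \<Longrightarrow> g x \<oplus>\<^bsub>cstar_image g A\<^esub> g y = g (x \<oplus> y)"
  "\<lbrakk>x \<in> carrier A; y \<in> carrier A\<rbrakk> \<Longrightarrow> g x \<otimes>\<^bsub>cstar_image g A\<^esub> g y = g (x \<otimes> y)"
  "x \<in> carrier A \<Longrightarrow> c \<odot>\<^bsub>cstar_image g A\<^esub> g x = g (c \<odot> x)"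
  "x \<in> carrier A \<Longrightarrow> adj\<^bsub>cstar_image g A\<^esub> g x = g (adj x)"
  "x \<in> carrier A \<Longrightarrow> \<parallel>g x\<parallel>\<^bsub>cstar_image g A\<^esub> = \<parallel>x\<parallel>"
  using inj by (simp_all add: cstar_image_def cstar.defs Let_def)

lemma abelian_group_cstar_image: "abelian_group (cstar_image g A)"
proof (rule abelian_groupI)
  fix x assume "x \<in> carrier (cstar_image g A)"
  then obtain a where "a \<in> carrier A" "x = g a"
    by auto
  then show "\<exists>y \<in> carrier (cstar_image g A). y \<oplus>\<^bsub>cstar_image g A\<^esub> x = \<zero>\<^bsub>cstar_image g A\<^esub>"
    by (intro bexI[of _ "g (\<ominus> a)"]) (auto simp: l_neg)
qed (auto simp: a_ac)

lemma diff_cstar_image: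
  assumes "x \<in> carrier A" "y \<in> carrier A"
  shows "g x \<ominus>\<^bsub>cstar_image g A\<^esub> g y = g (x \<ominus> y)"
proof -
  interpret im: abelian_group "cstar_image g A"
    by (rule abelian_group_cstar_image)
  have "\<ominus>\<^bsub>cstar_image g A\<^esub> g y = g (\<ominus> y)"
    using assms by (intro im.minus_equality) (auto simp: l_neg)
  then show ?thesis
    using assms by (simp add: a_minus_def)
qed

lemma cstar_algebra_cstar_image: "cstar_algebra (cstar_image g A)"
proof (intro cstar_algebra.intro abelian_group_cstar_image cstar_algebra_axioms.intro)
  fix X :: "nat \<Rightarrow> 'b"
  assume X: "range X \<subseteq> carrier (cstar_image g A)" "norm_Cauchy (cstar_image g A) X"
  then have "\<forall>n. \<exists>a. a \<in> carrier A \<and> X n = g a"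
    by (auto simp: image_subset_iff)
  then obtain Y where Y: "\<And>n. Y n \<in> carrier A" "\<And>n. X n = g (Y n)"
    by metis
  have "norm_Cauchy A Y"
    using X(2) Y unfolding norm_Cauchy_def by (simp add: diff_cstar_image)
  then obtain l where "l \<in> carrier A" "norm_convergent_to A Y l"
    using norm_complete[of Y] Y by blast
  then show "\<exists>l \<in> carrier (cstar_image g A). norm_convergent_to (cstar_image g A) X l"
    using Y by (intro bexI[of _ "g l"]) (auto simp: norm_convergent_to_def diff_cstar_image)
qed (auto simp: smult_add_right smult_add_left smult_smult smult_1 mult_assoc mult_add_left
    mult_add_right mult_smult_left mult_smult_right adj_add adj_smult adj_mult norm_nonneg
    norm_eq_0_iff norm_triangle norm_smult norm_mult_le norm_adj_mult inj_on_eq_iff[OF inj])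

lemma star_hom_cstar_image: "star_hom A (cstar_image g A) g"
  by (simp add: star_hom_def)

lemma star_hom_inv_cstar_image: "star_hom (cstar_image g A) A (inv_into (carrier A) g)"
  using inj by (auto simp: star_hom_def)

end

end

lemma star_hom_comp: "\<lbrakk>star_hom A B \<phi>; star_hom B C \<psi>\<rbrakk> \<Longrightarrow> star_hom A C (\<psi> \<circ> \<phi>)"
  by (auto simp: star_hom_def Pi_iff)

section \<open>Uniqueness of graph algebras\<close>

text \<open>For infinite \<open>I\<close> both sums are zero by convention. Thus the sums over
  \<open>out_arcs\<close> in the Cuntz-Krieger relations are preserved in every case.\<close>

lemma (in cstar_hom) hom_finsum:
  "f \<in> I \<rightarrow> carrier A \<Longrightarrow> \<phi> (finsum A f I) = (\<Oplus>\<^bsub>B\<^esub>i\<in>I. \<phi> (f i))"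
proof (induction I rule: infinite_finite_induct)
  case (insert i I)
  then show ?case
    by (simp add: Pi_iff)
qed auto

lemma (in cstar_hom) cuntz_krieger_family_hom:
  assumes ck: "cuntz_krieger_family E A P S"
  shows "cuntz_krieger_family E B (\<phi> \<circ> P) (\<phi> \<circ> S)"
proof -
  have P: "P v \<in> carrier A" if "v \<in> verts E" for v
    using ck that by (simp add: cuntz_krieger_family_def projection_def)
  have S: "S e \<in> carrier A" if "e \<in> arcs E" for e
    using ck that by (simp add: cuntz_krieger_family_def partial_isometry_def)
  show ?thesis
    unfolding cuntz_krieger_family_def
  proof (intro conjI ballI impI)
    fix v assume v: "v \<in> verts E"
    then have "P v \<otimes>\<^bsub>A\<^esub> P v = P v" "adj\<^bsub>A\<^esub> (P v) = P v"
      using ck by (auto simp: cuntz_krieger_family_def projection_def)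
    then show "projection B ((\<phi> \<circ> P) v)"
      using P[OF v] by (simp add: projection_def flip: hom_simps(3,5))
    fix w assume w: "w \<in> verts E" "v \<noteq> w"
    then have "P v \<otimes>\<^bsub>A\<^esub> P w = \<zero>\<^bsub>A\<^esub>"
      using v ck by (auto simp: cuntz_krieger_family_def)
    then show "(\<phi> \<circ> P) v \<otimes>\<^bsub>B\<^esub> (\<phi> \<circ> P) w = \<zero>\<^bsub>B\<^esub>"
      using P[OF v] P[OF w(1)] by (simp flip: hom_simps(3))
  next
    fix e assume e: "e \<in> arcs E"
    then have "S e \<otimes>\<^bsub>A\<^esub> adj\<^bsub>A\<^esub> S e \<otimes>\<^bsub>A\<^esub> S e = S e" "adj\<^bsub>A\<^esub> S e \<otimes>\<^bsub>A\<^esub> S e = P (head E e)"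
      using ck by (auto simp: cuntz_krieger_family_def partial_isometry_def)
    then show "partial_isometry B ((\<phi> \<circ> S) e)"
      "adj\<^bsub>B\<^esub> ((\<phi> \<circ> S) e) \<otimes>\<^bsub>B\<^esub> (\<phi> \<circ> S) e = (\<phi> \<circ> P) (head E e)"
      using S[OF e] by (simp_all add: partial_isometry_def flip: hom_simps(3,5))
  next
    fix v assume v: "v \<in> tail E ` arcs E"
    then have "P v = (\<Oplus>\<^bsub>A\<^esub>e\<in>out_arcs E v. S e \<otimes>\<^bsub>A\<^esub> adj\<^bsub>A\<^esub> (S e))"
      using ck unfolding cuntz_krieger_family_def by blast
    then have "\<phi> (P v) = (\<Oplus>\<^bsub>B\<^esub>e\<in>out_arcs E v. \<phi> (S e \<otimes>\<^bsub>A\<^esub> adj\<^bsub>A\<^esub> (S e)))"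
      using S by (simp add: hom_finsum Pi_iff)
    also have "\<dots> = (\<Oplus>\<^bsub>B\<^esub>e\<in>out_arcs E v. (\<phi> \<circ> S) e \<otimes>\<^bsub>B\<^esub> adj\<^bsub>B\<^esub> ((\<phi> \<circ> S) e))"
      using S by (intro cod.finsum_cong') auto
    finally show "(\<phi> \<circ> P) v = (\<Oplus>\<^bsub>B\<^esub>e\<in>out_arcs E v. (\<phi> \<circ> S) e \<otimes>\<^bsub>B\<^esub> adj\<^bsub>B\<^esub> ((\<phi> \<circ> S) e))"
      by simp
  qed
qed

lemma cuntz_krieger_family_in_carrier:
  assumes "cuntz_krieger_family E A P S"
  shows "P ` verts E \<union> S ` arcs E \<subseteq> carrier A"
  using assms by (auto simp: cuntz_krieger_family_def projection_def partial_isometry_def)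

text \<open>The universal property reaches only algebras on the reals. Countability of the graph
  makes \<open>B\<close> countably generated, hence \<open>B\<close> has a copy there; the
  homomorphism into the copy is composed with the inverse of the copying map.\<close>

lemma star_hom_between_graph_algebras:
  fixes E :: "('v, 'e) pre_digraph" and A :: "'a cstar" and B :: "'b cstar"
  assumes "countable (verts E)" "countable (arcs E)"
    and A: "\<And>(C :: real cstar) Q T. cstar_algebra C \<Longrightarrow> cuntz_krieger_family E C Q T \<Longrightarrow>
        \<exists>\<phi>. star_hom A C \<phi> \<and> (\<forall>v \<in> verts E. \<phi> (P v) = Q v) \<and> (\<forall>e \<in> arcs E. \<phi> (S e) = T e)"
    and B: "cstar_algebra B" "cuntz_krieger_family E B Q T"
      "generates_cstar B (Q ` verts E \<union> T ` arcs E)"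
  obtains \<phi> where "star_hom A B \<phi>" "\<And>v. v \<in> verts E \<Longrightarrow> \<phi> (P v) = Q v"
    "\<And>e. e \<in> arcs E \<Longrightarrow> \<phi> (S e) = T e"
proof -
  interpret B: cstar_algebra B
    by (rule B)
  obtain g :: "'b \<Rightarrow> real" where g: "inj_on g (carrier B)"
    using B.inj_into_real_if_countably_generated[OF _ B(3)] assms(1,2) by auto
  interpret g: cstar_hom B "cstar_image g B" g
    using B.cstar_algebra_cstar_image[OF g] B.star_hom_cstar_image[OF g] B(1)
    by (simp add: cstar_hom_def cstar_hom_axioms_def)
  obtain \<phi> where \<phi>: "star_hom A (cstar_image g B) \<phi>" "\<And>v. v \<in> verts E \<Longrightarrow> \<phi> (P v) = g (Q v)"
    "\<And>e. e \<in> arcs E \<Longrightarrow> \<phi> (S e) = g (T e)"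
    using A[OF g.cod.cstar_algebra_axioms g.cuntz_krieger_family_hom[OF B(2)]] by auto
  have "Q v \<in> carrier B" if "v \<in> verts E" for v
    using B(2) that by (simp add: cuntz_krieger_family_def projection_def)
  moreover have "T e \<in> carrier B" if "e \<in> arcs E" for e
    using B(2) that by (simp add: cuntz_krieger_family_def partial_isometry_def)
  ultimately show thesis
    using \<phi> g by (intro that[OF star_hom_comp[OF \<phi>(1) B.star_hom_inv_cstar_image[OF g]]]) auto
qed

lemma cstar_isomorphicI:
  assumes "star_hom A B \<phi>" "star_hom B A \<psi>" "\<And>x. x \<in> carrier A \<Longrightarrow> \<psi> (\<phi> x) = x"
    "\<And>y. y \<in> carrier B \<Longrightarrow> \<phi> (\<psi> y) = y"
  shows "cstar_isomorphic A B"
  unfolding cstar_isomorphic_def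
  by (intro exI[of _ \<phi>] conjI assms(1) bij_betw_byWitness[where f' = \<psi>])
    (use assms in \<open>auto simp: star_homD\<close>)

text \<open>Each universal property yields a homomorphism to the other algebra. Both composites fix
  the generators, hence are identities by contractivity.\<close>

lemma graph_algebra_unique:
  fixes E :: "('v, 'e) pre_digraph" and A :: "'a cstar" and B :: "'b cstar"
  assumes count: "countable (verts E)" "countable (arcs E)"
    and "is_graph_algebra E A" "is_graph_algebra E B"
  shows "cstar_isomorphic A B"
proof -
  obtain P S where A: "cstar_algebra A" "cuntz_krieger_family E A P S"
      "generates_cstar A (P ` verts E \<union> S ` arcs E)"
    and univ_A: "\<And>(C :: real cstar) Q T. cstar_algebra C \<Longrightarrow> cuntz_krieger_family E C Q T \<Longrightarrow>
        \<exists>\<phi>. star_hom A C \<phi> \<and> (\<forall>v \<in> verts E. \<phi> (P v) = Q v) \<and> (\<forall>e \<in> arcs E. \<phi> (S e) = T e)"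
    using assms(3) unfolding is_graph_algebra_def by blast
  obtain Q T where B: "cstar_algebra B" "cuntz_krieger_family E B Q T"
      "generates_cstar B (Q ` verts E \<union> T ` arcs E)"
    and univ_B: "\<And>(C :: real cstar) P S. cstar_algebra C \<Longrightarrow> cuntz_krieger_family E C P S \<Longrightarrow>
        \<exists>\<phi>. star_hom B C \<phi> \<and> (\<forall>v \<in> verts E. \<phi> (Q v) = P v) \<and> (\<forall>e \<in> arcs E. \<phi> (T e) = S e)"
    using assms(4) unfolding is_graph_algebra_def by blast
  obtain \<phi> where \<phi>: "star_hom A B \<phi>" "\<And>v. v \<in> verts E \<Longrightarrow> \<phi> (P v) = Q v"
    "\<And>e. e \<in> arcs E \<Longrightarrow> \<phi> (S e) = T e"
    using star_hom_between_graph_algebras[OF count univ_A B] by blast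
  obtain \<psi> where \<psi>: "star_hom B A \<psi>" "\<And>v. v \<in> verts E \<Longrightarrow> \<psi> (Q v) = P v"
    "\<And>e. e \<in> arcs E \<Longrightarrow> \<psi> (T e) = S e"
    using star_hom_between_graph_algebras[OF count univ_B A] by blast
  show ?thesis
  proof (rule cstar_isomorphicI[OF \<phi>(1) \<psi>(1)])
    show "\<psi> (\<phi> x) = x" if "x \<in> carrier A" for x
      using star_hom_eq_id_if_fixes_generators[OF A(1) star_hom_comp[OF \<phi>(1) \<psi>(1)] A(3) _ that]
        \<phi>(2,3) \<psi>(2,3) by fastforce
    show "\<phi> (\<psi> x) = x" if "x \<in> carrier B" for x
      using star_hom_eq_id_if_fixes_generators[OF B(1) star_hom_comp[OF \<psi>(1) \<phi>(1)] B(3) _ that]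
        \<phi>(2,3) \<psi>(2,3) by fastforce
  qed
qed

section \<open>Cuntz-Krieger families\<close>

context cstar_algebra
begin

lemma finsum_mult_left:
  "\<lbrakk>f \<in> I \<rightarrow> carrier A; x \<in> carrier A\<rbrakk> \<Longrightarrow> finsum A f I \<otimes> x = (\<Oplus>i\<in>I. f i \<otimes> x)"
  by (induction I rule: infinite_finite_induct) (simp_all add: Pi_iff mult_add_left)

lemma finsum_mult_right:
  "\<lbrakk>f \<in> I \<rightarrow> carrier A; x \<in> carrier A\<rbrakk> \<Longrightarrow> x \<otimes> finsum A f I = (\<Oplus>i\<in>I. x \<otimes> f i)"
  by (induction I rule: infinite_finite_induct) (simp_all add: Pi_iff mult_add_right)

lemma adj_finsum: "f \<in> I \<rightarrow> carrier A \<Longrightarrow> adj (finsum A f I) = (\<Oplus>i\<in>I. adj (f i))"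
  by (induction I rule: infinite_finite_induct) (simp_all add: Pi_iff adj_add)

lemma finsum_eq_zero:
  assumes "\<And>i. i \<in> I \<Longrightarrow> f i = \<zero>"
  shows "finsum A f I = \<zero>"
  using finsum_cong'[of I I "\<lambda>_. \<zero>" f] assms by simp

lemma finsum_eq_single:
  assumes "finite I" "i \<in> I" "f i \<in> carrier A" "\<And>j. j \<in> I \<Longrightarrow> j \<noteq> i \<Longrightarrow> f j = \<zero>"
  shows "finsum A f I = f i"
proof -
  have "finsum A f (insert i (I - {i})) = f i \<oplus> finsum A f (I - {i})"
    using assms by (intro finsum_insert) (auto simp: Pi_iff)
  also have "finsum A f (I - {i}) = \<zero>"
    using assms by (intro finsum_eq_zero) auto
  finally show ?thesis
    using assms by (simp add: insert_absorb)
qed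

text \<open>Two families over one index set are allowed, so that it serves for projections as well
  as for products of partial isometries with their adjoints.\<close>

lemma finsum_mult_finsum_orthogonal:
  assumes "finite I" "f \<in> I \<rightarrow> carrier A" "g \<in> I \<rightarrow> carrier A"
    and "\<And>i j. \<lbrakk>i \<in> I; j \<in> I; i \<noteq> j\<rbrakk> \<Longrightarrow> f i \<otimes> g j = \<zero>"
  shows "finsum A f I \<otimes> finsum A g I = (\<Oplus>i\<in>I. f i \<otimes> g i)"
proof -
  have "finsum A f I \<otimes> finsum A g I = (\<Oplus>i\<in>I. f i \<otimes> finsum A g I)"
    using assms by (intro finsum_mult_left) auto
  also have "\<dots> = (\<Oplus>i\<in>I. f i \<otimes> g i)"
  proof (intro finsum_cong')
    fix i assume i: "i \<in> I"
    then have "f i \<otimes> finsum A g I = (\<Oplus>j\<in>I. f i \<otimes> g j)"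
      using assms by (intro finsum_mult_right) auto
    also have "\<dots> = f i \<otimes> g i"
      using assms i by (intro finsum_eq_single) (auto simp: Pi_iff)
    finally show "f i \<otimes> finsum A g I = f i \<otimes> g i" .
  qed (use assms in \<open>auto simp: Pi_iff\<close>)
  finally show ?thesis .
qed

lemma finsum_fibres:
  assumes "finite I" "finite J" "h \<in> I \<rightarrow> J" "f \<in> I \<rightarrow> carrier A"
  shows "finsum A f I = (\<Oplus>j\<in>J. finsum A f {i \<in> I. h i = j})"
proof -
  have "I = (\<Union>j\<in>J. {i \<in> I. h i = j})"
    using assms by auto
  moreover have "finsum A f (\<Union>j\<in>J. {i \<in> I. h i = j}) = (\<Oplus>j\<in>J. finsum A f {i \<in> I. h i = j})"
    using assms by (intro add.finprod_UN_disjoint) (auto simp: pairwise_def disjnt_def)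
  ultimately show ?thesis
    by simp
qed

lemma finsum_image_eq:
  assumes "inj_on h I" "h ` I = J" "\<And>i. i \<in> I \<Longrightarrow> f (h i) = g i" "f \<in> J \<rightarrow> carrier A"
  shows "finsum A f J = finsum A g I"
proof -
  have "finsum A f (h ` I) = (\<Oplus>i\<in>I. f (h i))"
    using assms by (intro finsum_reindex) auto
  also have "\<dots> = finsum A g I"
    using assms by (intro finsum_cong') (auto simp: Pi_iff)
  finally show ?thesis
    using assms by simp
qed

lemma projection_finsum:
  assumes "finite I" "\<And>i. i \<in> I \<Longrightarrow> projection A (p i)"
    and "\<And>i j. \<lbrakk>i \<in> I; j \<in> I; i \<noteq> j\<rbrakk> \<Longrightarrow> p i \<otimes> p j = \<zero>"
  shows "projection A (finsum A p I)"
proof -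
  have p: "p i \<in> carrier A" "p i \<otimes> p i = p i" "adj (p i) = p i" if "i \<in> I" for i
    using assms(2)[OF that] by (auto simp: projection_def)
  have "finsum A p I \<otimes> finsum A p I = (\<Oplus>i\<in>I. p i \<otimes> p i)"
    using assms p by (intro finsum_mult_finsum_orthogonal) auto
  also have "\<dots> = finsum A p I"
    using p by (intro finsum_cong') auto
  moreover have "adj (finsum A p I) = (\<Oplus>i\<in>I. adj (p i))"
    using p by (intro adj_finsum) auto
  moreover have "\<dots> = finsum A p I"
    using p by (intro finsum_cong') auto
  ultimately show ?thesis
    using p by (simp add: projection_def Pi_iff)
qed

lemma finsum_in_closed_star_subalgebra:
  assumes "closed_star_subalgebra A B" "\<And>i. i \<in> I \<Longrightarrow> f i \<in> B"
  shows "finsum A f I \<in> B"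
proof -
  have B: "B \<subseteq> carrier A" "\<zero> \<in> B" "\<And>x y. \<lbrakk>x \<in> B; y \<in> B\<rbrakk> \<Longrightarrow> x \<oplus> y \<in> B"
    using assms(1) by (simp_all add: closed_star_subalgebra_def)
  show ?thesis
    using assms(2)
  proof (induction I rule: infinite_finite_induct)
    case (insert i I)
    have "f \<in> I \<rightarrow> carrier A" "f i \<in> carrier A"
      using insert.prems B(1) by auto
    then show ?case
      using insert B by simp
  qed (use B in auto)
qed

end

locale ck_family = cstar_algebra A + graph: nomulti_digraph E
  for A :: "'a cstar" (structure) and E :: "('v, 'e) pre_digraph" +
  fixes P :: "'v \<Rightarrow> 'a" and S :: "'e \<Rightarrow> 'a"
  assumes row_finite: "row_finite E" and ck: "cuntz_krieger_family E A P S"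
begin

lemma P_projection: "v \<in> verts E \<Longrightarrow> projection A (P v)"
  using ck by (simp add: cuntz_krieger_family_def)

lemma P_simps [simp]:
  assumes "v \<in> verts E"
  shows "P v \<in> carrier A" "P v \<otimes> P v = P v" "adj (P v) = P v"
  using P_projection[OF assms] by (simp_all add: projection_def)

lemma P_orthogonal: "\<lbrakk>v \<in> verts E; w \<in> verts E; v \<noteq> w\<rbrakk> \<Longrightarrow> P v \<otimes> P w = \<zero>"
  using ck by (simp add: cuntz_krieger_family_def)

lemma S_closed [simp]: "e \<in> arcs E \<Longrightarrow> S e \<in> carrier A"
  using ck by (simp add: cuntz_krieger_family_def partial_isometry_def)

lemma adj_S_mult_S: "e \<in> arcs E \<Longrightarrow> adj (S e) \<otimes> S e = P (head E e)"
  using ck by (simp add: cuntz_krieger_family_def)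

lemma S_mult_P_head:
  assumes "e \<in> arcs E"
  shows "S e \<otimes> P (head E e) = S e"
proof -
  have "S e \<otimes> adj (S e) \<otimes> S e = S e"
    using ck assms by (simp add: cuntz_krieger_family_def partial_isometry_def)
  then show ?thesis
    using assms by (simp add: mult_assoc adj_S_mult_S)
qed

lemma S_mult_P_eq_zero:
  assumes "e \<in> arcs E" "w \<in> verts E" "head E e \<noteq> w"
  shows "S e \<otimes> P w = \<zero>"
proof -
  have "S e \<otimes> P w = S e \<otimes> (P (head E e) \<otimes> P w)"
    using assms by (simp add: S_mult_P_head flip: mult_assoc)
  then show ?thesis
    using assms by (simp add: P_orthogonal)
qed

lemma P_head_mult_adj_S: "e \<in> arcs E \<Longrightarrow> P (head E e) \<otimes> adj (S e) = adj (S e)"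
  using adj_mult[of "S e" "P (head E e)"] by (simp add: S_mult_P_head)

text \<open>The initial projections of the two edges belong to distinct vertices; one of them may be
  inserted between the factors.\<close>

lemma S_mult_adj_S_eq_zero:
  assumes "e \<in> arcs E" "f \<in> arcs E" "head E e \<noteq> head E f"
  shows "S e \<otimes> adj (S f) = \<zero>"
proof -
  have "S e \<otimes> adj (S f) = S e \<otimes> P (head E f) \<otimes> adj (S f)"
    using assms by (simp add: mult_assoc P_head_mult_adj_S)
  then show ?thesis
    using assms by (simp add: S_mult_P_eq_zero)
qed

lemma finite_out_arcs: "v \<in> verts E \<Longrightarrow> finite (out_arcs E v)"
  using row_finite by (simp add: row_finite_def)

lemma P_tail_eq_finsum:
  "e \<in> arcs E \<Longrightarrow> P (tail E e) = (\<Oplus>f\<in>out_arcs E (tail E e). S f \<otimes> adj (S f))"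
  using ck unfolding cuntz_krieger_family_def by blast

text \<open>This is where the absence of multiple edges enters: edges leaving one vertex are told
  apart by their ranges, hence by the orthogonal projections \<open>P\<close>.\<close>

lemma head_neq_head: "\<lbrakk>e \<in> arcs E; f \<in> arcs E; tail E e = tail E f; e \<noteq> f\<rbrakk> \<Longrightarrow> head E e \<noteq> head E f"
  using graph.no_multi_arcs by (auto simp: arc_to_ends_def)

text \<open>The relations only say that the sum of the range projections of the edges leaving a vertex is
  a projection. In the absence of multiple edges, orthogonality of these projections follows without
  positivity arguments: the sum \<open>R\<close> of these edges satisfies \<open>S e = R P\<^bsub>r(e)\<^esub>\<close> and is itself a
  partial isometry with final projection \<open>P v\<close>.\<close>

lemma row_sum:
  assumes e: "e \<in> arcs E"
  defines "R \<equiv> finsum A S (out_arcs E (tail E e))"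
  shows "R \<in> carrier A" "R \<otimes> P (head E e) = S e" "P (tail E e) \<otimes> R = R"
    "adj R \<otimes> S e = P (head E e)"
proof -
  let ?I = "out_arcs E (tail E e)" and ?p = "P (head E e)" and ?v = "P (tail E e)"
  have fin: "finite ?I"
    using e finite_out_arcs by simp
  have S: "S \<in> ?I \<rightarrow> carrier A"
    by auto
  show R: "R \<in> carrier A"
    unfolding R_def using S by simp
  have "R \<otimes> ?p = (\<Oplus>f\<in>?I. S f \<otimes> ?p)"
    unfolding R_def using S e by (intro finsum_mult_left) auto
  also have "\<dots> = S e \<otimes> ?p"
    using e fin by (intro finsum_eq_single S_mult_P_eq_zero) (auto dest: head_neq_head)
  finally show Rp: "R \<otimes> ?p = S e"
    using e by (simp add: S_mult_P_head)
  have "adj R = (\<Oplus>f\<in>?I. adj (S f))"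
    unfolding R_def using S by (rule adj_finsum)
  \<comment> \<open>The mixed terms vanish because distinct edges from one vertex have distinct
    ranges.\<close>
  then have "R \<otimes> adj R = (\<Oplus>f\<in>?I. S f \<otimes> adj (S f))"
    unfolding R_def using fin S
    by (simp only:) (intro finsum_mult_finsum_orthogonal S_mult_adj_S_eq_zero, auto dest: head_neq_head)
  then have RR: "R \<otimes> adj R = ?v"
    using e by (simp add: P_tail_eq_finsum)
  have v: "?v \<in> carrier A" "?v \<otimes> ?v = ?v" "adj ?v = ?v" and p: "?p \<in> carrier A" "?p \<otimes> ?p = ?p" "adj ?p = ?p"
    using e by simp_all
  have RR': "R \<otimes> (adj R \<otimes> x) = ?v \<otimes> x" if "x \<in> carrier A" for x
    using R that by (simp add: RR flip: mult_assoc)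
  \<comment> \<open>As \<open>R \<otimes> adj R\<close> is the projection \<open>?v\<close>, all
    four products of the two sides with their adjoints reduce to \<open>?v\<close>.\<close>
  have "adj R \<otimes> ?v = adj R"
    by (rule eq_if_adj_mult_eq[where z = ?v])
      (use R v in \<open>simp_all add: adj_mult mult_assoc RR RR'\<close>)
  then have "adj (adj R \<otimes> ?v) = adj (adj R)"
    by simp
  then show vR: "?v \<otimes> R = R"
    using R v by (simp add: adj_mult)
  have "adj (S e) \<otimes> S e = adj (R \<otimes> ?p) \<otimes> (R \<otimes> ?p)"
    by (simp add: Rp)
  then have pqp: "?p \<otimes> (adj R \<otimes> (R \<otimes> ?p)) = ?p"
    using R p e by (simp add: adj_S_mult_S adj_mult mult_assoc)
  have vRp: "?v \<otimes> (R \<otimes> ?p) = R \<otimes> ?p"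
    using R p v by (simp add: vR flip: mult_assoc)
  \<comment> \<open>So far \<open>pqp\<close> gives this only after compression by
    \<open>?p\<close>. Since \<open>R\<close> is now known to be a partial isometry,
    \<open>adj R \<otimes> R\<close> is idempotent, and the square of the left-hand side collapses
    to \<open>?p\<close> too.\<close>
  have "adj R \<otimes> (R \<otimes> ?p) = ?p"
    by (rule eq_if_adj_mult_eq[where z = ?p])
      (use R p in \<open>simp_all add: adj_mult mult_assoc pqp RR' vRp\<close>)
  then show "adj R \<otimes> S e = ?p"
    by (simp add: Rp)
qed

lemma P_tail_mult_S:
  assumes "e \<in> arcs E"
  shows "P (tail E e) \<otimes> S e = S e"
  using row_sum[OF assms] assms by (metis mult_assoc P_simps(1) graph.head_in_verts graph.tail_in_verts)

lemma P_mult_S_eq_zero: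
  assumes "e \<in> arcs E" "w \<in> verts E" "w \<noteq> tail E e"
  shows "P w \<otimes> S e = \<zero>"
proof -
  have "P w \<otimes> S e = P w \<otimes> P (tail E e) \<otimes> S e"
    using assms by (simp add: mult_assoc P_tail_mult_S)
  then show ?thesis
    using assms by (simp add: P_orthogonal)
qed

lemma adj_S_mult_P_tail: "e \<in> arcs E \<Longrightarrow> adj (S e) \<otimes> P (tail E e) = adj (S e)"
  using adj_mult[of "P (tail E e)" "S e"] by (simp add: P_tail_mult_S)

text \<open>For a common source, both edges are cut out of the same row sum \<open>R\<close>, and
  the product becomes that of the projections of their distinct ranges. For different sources, the
  projection of one source is inserted in the middle.\<close>

lemma adj_S_mult_S_eq_zero:
  assumes "e \<in> arcs E" "f \<in> arcs E" "e \<noteq> f"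
  shows "adj (S e) \<otimes> S f = \<zero>"
proof (cases "tail E e = tail E f")
  case True
  define R where "R = finsum A S (out_arcs E (tail E e))"
  have R: "R \<in> carrier A" "R \<otimes> P (head E e) = S e" "adj R \<otimes> S f = P (head E f)"
    using row_sum[OF assms(1)] row_sum[OF assms(2)] True by (simp_all add: R_def)
  have "adj (S e) = P (head E e) \<otimes> adj R"
    using R(1) assms by (simp add: adj_mult flip: R(2))
  then have "adj (S e) \<otimes> S f = P (head E e) \<otimes> P (head E f)"
    using R(1,3) assms by (simp add: mult_assoc)
  then show ?thesis
    using True assms by (simp add: P_orthogonal head_neq_head)
next
  case False
  have "adj (S e) \<otimes> S f = adj (S e) \<otimes> P (tail E e) \<otimes> S f"
    using assms by (simp add: adj_S_mult_P_tail)
  also have "\<dots> = \<zero>"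
    using assms False by (simp add: mult_assoc P_mult_S_eq_zero)
  finally show ?thesis .
qed

lemma range_projection:
  assumes "e \<in> arcs E"
  shows "projection A (S e \<otimes> adj (S e))"
proof -
  have "S e \<otimes> adj (S e) \<otimes> (S e \<otimes> adj (S e)) = S e \<otimes> (adj (S e) \<otimes> S e) \<otimes> adj (S e)"
    using assms by (simp add: mult_assoc)
  also have "\<dots> = S e \<otimes> adj (S e)"
    using assms by (simp add: adj_S_mult_S S_mult_P_head)
  finally show ?thesis
    using assms by (simp add: projection_def adj_mult)
qed

lemma range_projections_orthogonal:
  assumes "e \<in> arcs E" "f \<in> arcs E" "e \<noteq> f"
  shows "S e \<otimes> adj (S e) \<otimes> (S f \<otimes> adj (S f)) = \<zero>"
proof -
  have "S e \<otimes> adj (S e) \<otimes> (S f \<otimes> adj (S f)) = S e \<otimes> (adj (S e) \<otimes> S f) \<otimes> adj (S f)"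
    using assms by (simp add: mult_assoc)
  then show ?thesis
    using assms by (simp add: adj_S_mult_S_eq_zero)
qed

end

section \<open>Out-splittings\<close>

text \<open>The map \<open>pr\<close> sends the copies of a vertex to that vertex, \<open>lab\<close> sends the copies of an edge to
  that edge, and \<open>lift f\<close> is the copy of the source of \<open>f\<close> from which all copies of \<open>f\<close> depart. By
  \<open>lift_if_split\<close>, each copy of a vertex with several copies emits an edge.\<close>

locale out_split = base: nomulti_digraph E for E :: "('v, 'e) pre_digraph" +
  fixes F :: "('w, 'f) pre_digraph" and pr :: "'w \<Rightarrow> 'v" and lift :: "'e \<Rightarrow> 'w" and lab :: "'f \<Rightarrow> 'e"
  assumes pr_verts: "pr ` verts F = verts E"
    and finite_fibre: "finite {y \<in> verts F. pr y = u}"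
    and lift_verts [simp]: "f \<in> arcs E \<Longrightarrow> lift f \<in> verts F"
    and pr_lift [simp]: "f \<in> arcs E \<Longrightarrow> pr (lift f) = tail E f"
    and lift_if_split: "\<lbrakk>y \<in> verts F; z \<in> verts F; pr y = pr z; y \<noteq> z\<rbrakk> \<Longrightarrow> y \<in> lift ` arcs E"
    and lab_arcs [simp]: "a \<in> arcs F \<Longrightarrow> lab a \<in> arcs E"
    and tail_eq_lift: "a \<in> arcs F \<Longrightarrow> tail F a = lift (lab a)"
    and head_verts [simp]: "a \<in> arcs F \<Longrightarrow> head F a \<in> verts F"
    and pr_head [simp]: "a \<in> arcs F \<Longrightarrow> pr (head F a) = head E (lab a)"
    and ex_arc: "\<lbrakk>f \<in> arcs E; y \<in> verts F; pr y = head E f\<rbrakk> \<Longrightarrow> \<exists>a \<in> arcs F. lab a = f \<and> head F a = y"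
    and arc_eqI: "\<lbrakk>a \<in> arcs F; b \<in> arcs F; lab a = lab b; head F a = head F b\<rbrakk> \<Longrightarrow> a = b"
begin

abbreviation fibre :: "'v \<Rightarrow> 'w set" where
  "fibre u \<equiv> {y \<in> verts F. pr y = u}"

abbreviation part :: "'w \<Rightarrow> 'e set" where
  "part y \<equiv> {f \<in> arcs E. lift f = y}"

abbreviation arcs_over :: "'e \<Rightarrow> 'f set" where
  "arcs_over f \<equiv> {a \<in> arcs F. lab a = f}"

lemma pr_in_verts [simp]: "y \<in> verts F \<Longrightarrow> pr y \<in> verts E"
  using pr_verts by blast

lemma ex_in_fibre:
  assumes "u \<in> verts E"
  obtains y where "y \<in> verts F" "pr y = u"
proof -
  have "u \<in> pr ` verts F"
    using assms by (simp add: pr_verts)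
  then show thesis
    using that by auto
qed

text \<open>Applying \<open>pr\<close> to the ends of an arc gives the ends of the edge below it,
  which is therefore determined; \<open>arc_eqI\<close> does the rest. Consequently the results on
  \<open>ck_family\<close> apply to \<open>F\<close> as well.\<close>

lemma nomulti_split: "nomulti_digraph F"
proof
  fix a b assume ab: "a \<in> arcs F" "b \<in> arcs F" "arc_to_ends F a = arc_to_ends F b"
  then have "lift (lab a) = lift (lab b)" "head F a = head F b"
    by (auto simp: arc_to_ends_def tail_eq_lift)
  then have "tail E (lab a) = tail E (lab b)" "head E (lab a) = head E (lab b)"
    using ab(1,2) by (metis pr_lift lab_arcs, metis pr_head)
  then have "lab a = lab b"
    using base.no_multi_arcs ab(1,2) by (simp add: arc_to_ends_def)
  then show "a = b"
    using arc_eqI ab(1,2) \<open>head F a = head F b\<close> by blast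
qed (simp_all add: tail_eq_lift)

lemma inj_on_head: "inj_on (head F) (arcs_over f)"
  by (auto intro!: inj_onI arc_eqI)

lemma head_arcs_over: "f \<in> arcs E \<Longrightarrow> head F ` arcs_over f = fibre (head E f)"
  using ex_arc by (auto simp: image_iff)

lemma finite_arcs_over: "f \<in> arcs E \<Longrightarrow> finite (arcs_over f)"
  by (rule finite_imageD[OF _ inj_on_head]) (simp add: head_arcs_over finite_fibre)

lemma ex_arc_over:
  assumes "f \<in> arcs E"
  shows "\<exists>a \<in> arcs F. lab a = f"
proof -
  obtain y where "y \<in> verts F" "pr y = head E f"
    using base.head_in_verts[OF assms] by (rule ex_in_fibre)
  then show ?thesis
    using ex_arc[OF assms] by blast
qed

lemma row_finite_split:
  assumes "row_finite E"
  shows "row_finite F"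
  unfolding row_finite_def
proof
  fix y assume y: "y \<in> verts F"
  have "out_arcs F y \<subseteq> (\<Union>f \<in> out_arcs E (pr y). arcs_over f)"
    by (auto simp: tail_eq_lift)
  moreover have "finite (\<Union>f \<in> out_arcs E (pr y). arcs_over f)"
    using assms y finite_arcs_over by (auto simp: row_finite_def)
  ultimately show "finite (out_arcs F y)"
    by (rule finite_subset)
qed

text \<open>Every edge has a copy because the fibre over its range is not empty. So
  \<open>lab\<close> maps the arcs leaving the finitely many copies of \<open>u\<close> onto the
  edges leaving \<open>u\<close>.\<close>

lemma row_finite_unsplit:
  assumes "row_finite F"
  shows "row_finite E"
  unfolding row_finite_def
proof
  fix u
  have "out_arcs E u \<subseteq> lab ` (\<Union>y \<in> fibre u. out_arcs F y)"
  proof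
    fix f assume f: "f \<in> out_arcs E u"
    then obtain a where "a \<in> arcs F" "lab a = f"
      using ex_arc_over by auto
    then show "f \<in> lab ` (\<Union>y \<in> fibre u. out_arcs F y)"
      using f by (auto simp: tail_eq_lift intro!: image_eqI[of _ _ a])
  qed
  moreover have "finite (\<Union>y \<in> fibre u. out_arcs F y)"
    using assms finite_fibre by (auto simp: row_finite_def)
  ultimately show "finite (out_arcs E u)"
    using finite_surj by blast
qed

text \<open>With a second copy present, \<open>lift_if_split\<close> would make \<open>y\<close>
  emit an edge. Hence the value \<open>P (pr y)\<close> that \<open>split_P\<close> takes at such a
  \<open>y\<close> competes with no other copy of the vertex.\<close>

lemma fibre_of_non_lift:
  assumes "y \<in> verts F" "y \<notin> lift ` arcs E"
  shows "fibre (pr y) = {y}"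
proof -
  have "z = y" if "z \<in> fibre (pr y)" for z
    using lift_if_split[of y z] that assms by auto
  then show ?thesis
    using assms by auto
qed

lemma fibre_subset_lift:
  assumes "f \<in> arcs E"
  shows "fibre (tail E f) \<subseteq> lift ` arcs E"
proof
  fix y assume "y \<in> fibre (tail E f)"
  then show "y \<in> lift ` arcs E"
    using lift_if_split[of y "lift f"] assms by (cases "y = lift f") auto
qed

definition split_P :: "'a cstar \<Rightarrow> ('v \<Rightarrow> 'a) \<Rightarrow> ('e \<Rightarrow> 'a) \<Rightarrow> 'w \<Rightarrow> 'a" where
  "split_P A P S y =
    (if y \<in> lift ` arcs E then \<Oplus>\<^bsub>A\<^esub>f\<in>part y. S f \<otimes>\<^bsub>A\<^esub> adj\<^bsub>A\<^esub> (S f) else P (pr y))"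

definition split_S :: "'a cstar \<Rightarrow> ('v \<Rightarrow> 'a) \<Rightarrow> ('e \<Rightarrow> 'a) \<Rightarrow> 'f \<Rightarrow> 'a" where
  "split_S A P S a = S (lab a) \<otimes>\<^bsub>A\<^esub> split_P A P S (head F a)"

definition merge_P :: "'a cstar \<Rightarrow> ('w \<Rightarrow> 'a) \<Rightarrow> 'v \<Rightarrow> 'a" where
  "merge_P A Q u = (\<Oplus>\<^bsub>A\<^esub>y\<in>fibre u. Q y)"

definition merge_S :: "'a cstar \<Rightarrow> ('f \<Rightarrow> 'a) \<Rightarrow> 'e \<Rightarrow> 'a" where
  "merge_S A T f = (\<Oplus>\<^bsub>A\<^esub>a\<in>arcs_over f. T a)"

end

section \<open>Splitting a Cuntz-Krieger family\<close>

locale split_family = out_split E F pr lift lab + ck_family A E P S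
  for A :: "'a cstar" (structure) and E :: "('v, 'e) pre_digraph"
    and F :: "('w, 'f) pre_digraph" and pr lift lab P S
begin

abbreviation Q :: "'w \<Rightarrow> 'a" where "Q \<equiv> split_P A P S"
abbreviation T :: "'f \<Rightarrow> 'a" where "T \<equiv> split_S A P S"

lemma finite_part: "y \<in> verts F \<Longrightarrow> finite (part y)"
  using finite_out_arcs[of "pr y"] by (rule finite_subset[rotated]) auto

lemma Q_projection:
  assumes y: "y \<in> verts F"
  shows "projection A (Q y)"
proof (cases "y \<in> lift ` arcs E")
  case True
  then show ?thesis
    using finite_part[OF y]
    by (auto simp: split_P_def intro!: projection_finsum range_projection range_projections_orthogonal)
qed (simp add: split_P_def P_projection y)

lemma Q_simps [simp]:
  assumes "y \<in> verts F"
  shows "Q y \<in> carrier A" "Q y \<otimes> Q y = Q y" "adj (Q y) = Q y"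
  using Q_projection[OF assms] by (simp_all add: projection_def)

lemma P_mult_Q:
  assumes y: "y \<in> verts F"
  shows "P (pr y) \<otimes> Q y = Q y"
proof (cases "y \<in> lift ` arcs E")
  case True
  have "P (pr y) \<otimes> (\<Oplus>f\<in>part y. S f \<otimes> adj (S f)) = (\<Oplus>f\<in>part y. P (pr y) \<otimes> (S f \<otimes> adj (S f)))"
    using y by (intro finsum_mult_right) auto
  also have "\<dots> = (\<Oplus>f\<in>part y. S f \<otimes> adj (S f))"
    using y by (intro finsum_cong') (auto simp: P_tail_mult_S simp flip: mult_assoc)
  finally show ?thesis
    using True by (simp add: split_P_def)
qed (simp add: split_P_def y)

lemma Q_mult_P: "y \<in> verts F \<Longrightarrow> Q y \<otimes> P (pr y) = Q y"
  using adj_mult[of "P (pr y)" "Q y"] by (simp add: P_mult_Q)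

text \<open>Two copies of one vertex both emit edges, and their projections are sums over disjoint
  sets of edges. Copies of different vertices lie under orthogonal projections
  \<open>P\<close>.\<close>

lemma Q_orthogonal:
  assumes "y \<in> verts F" "z \<in> verts F" "y \<noteq> z"
  shows "Q y \<otimes> Q z = \<zero>"
proof (cases "pr y = pr z")
  case True
  let ?p = "\<lambda>f. S f \<otimes> adj (S f)"
  have "y \<in> lift ` arcs E" "z \<in> lift ` arcs E"
    using assms True lift_if_split[of y z] lift_if_split[of z y] by auto
  then have "Q y \<otimes> Q z = (\<Oplus>f\<in>part y. ?p f) \<otimes> (\<Oplus>g\<in>part z. ?p g)"
    by (simp add: split_P_def)
  also have "\<dots> = (\<Oplus>f\<in>part y. ?p f \<otimes> (\<Oplus>g\<in>part z. ?p g))"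
    by (rule finsum_mult_left) (auto simp: Pi_iff)
  also have "\<dots> = \<zero>"
  proof (rule finsum_eq_zero)
    fix f assume f: "f \<in> part y"
    then have "?p f \<otimes> (\<Oplus>g\<in>part z. ?p g) = (\<Oplus>g\<in>part z. ?p f \<otimes> ?p g)"
      by (intro finsum_mult_right) auto
    also have "\<dots> = \<zero>"
      using f assms(3) by (intro finsum_eq_zero range_projections_orthogonal) auto
    finally show "?p f \<otimes> (\<Oplus>g\<in>part z. ?p g) = \<zero>" .
  qed
  finally show ?thesis .
next
  case False
  have "Q y \<otimes> Q z = Q y \<otimes> P (pr y) \<otimes> (P (pr z) \<otimes> Q z)"
    using assms by (simp add: P_mult_Q Q_mult_P)
  also have "\<dots> = Q y \<otimes> (P (pr y) \<otimes> P (pr z)) \<otimes> Q z"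
    using assms by (simp add: mult_assoc)
  finally show ?thesis
    using assms False by (simp add: P_orthogonal)
qed

text \<open>If \<open>u\<close> emits edges, \<open>lift\<close> partitions them among the copies
  and the Cuntz-Krieger relation at \<open>u\<close> is regrouped. If \<open>u\<close> is a sink, it
  has a single copy, which carries \<open>P u\<close>.\<close>

lemma finsum_Q_fibre:
  assumes u: "u \<in> verts E"
  shows "(\<Oplus>y\<in>fibre u. Q y) = P u"
proof (cases "u \<in> tail E ` arcs E")
  case True
  then obtain f where f: "f \<in> arcs E" "u = tail E f"
    by auto
  have "P u = (\<Oplus>y\<in>fibre u. \<Oplus>f\<in>{f \<in> out_arcs E u. lift f = y}. S f \<otimes> adj (S f))"
    unfolding f(2) P_tail_eq_finsum[OF f(1)]
    using f finite_out_arcs finite_fibre by (intro finsum_fibres) auto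
  also have "\<dots> = (\<Oplus>y\<in>fibre u. Q y)"
  proof (rule finsum_cong'[OF refl])
    fix y assume y: "y \<in> fibre u"
    then have "{f \<in> out_arcs E u. lift f = y} = part y"
      by auto
    then show "(\<Oplus>f\<in>{f \<in> out_arcs E u. lift f = y}. S f \<otimes> adj (S f)) = Q y"
      using y fibre_subset_lift[OF f(1)] f(2) by (auto simp: split_P_def)
  qed auto
  finally show ?thesis
    by simp
next
  case False
  obtain y where y: "y \<in> verts F" "pr y = u"
    using u by (rule ex_in_fibre)
  moreover have "y \<notin> lift ` arcs E"
    using False y by auto
  ultimately show ?thesis
    using fibre_of_non_lift[of y] u by (simp add: split_P_def)
qed

lemma finsum_arcs_over:
  assumes "f \<in> arcs E"
  shows "(\<Oplus>a\<in>arcs_over f. Q (head F a)) = P (head E f)"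
proof -
  have "(\<Oplus>y\<in>fibre (head E f). Q y) = (\<Oplus>a\<in>arcs_over f. Q (head F a))"
    by (rule finsum_image_eq[OF inj_on_head head_arcs_over[OF assms]]) auto
  then show ?thesis
    using assms finsum_Q_fibre by simp
qed

lemma T_closed [simp]: "a \<in> arcs F \<Longrightarrow> T a \<in> carrier A"
  by (simp add: split_S_def)

lemma adj_T_mult_T:
  assumes "a \<in> arcs F"
  shows "adj (T a) \<otimes> T a = Q (head F a)"
proof -
  have "adj (T a) \<otimes> T a = Q (head F a) \<otimes> (adj (S (lab a)) \<otimes> S (lab a)) \<otimes> Q (head F a)"
    using assms by (simp add: split_S_def adj_mult mult_assoc)
  also have "\<dots> = Q (head F a) \<otimes> P (pr (head F a)) \<otimes> Q (head F a)"
    using assms by (simp add: adj_S_mult_S)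
  finally show ?thesis
    using assms by (simp only: Q_mult_P head_verts Q_simps)
qed

lemma partial_isometry_T:
  assumes "a \<in> arcs F"
  shows "partial_isometry A (T a)"
proof -
  have "T a \<otimes> adj (T a) \<otimes> T a = T a \<otimes> Q (head F a)"
    using assms by (simp add: mult_assoc adj_T_mult_T)
  also have "\<dots> = T a"
    using assms by (simp add: split_S_def mult_assoc)
  finally show ?thesis
    using assms by (simp add: partial_isometry_def)
qed

lemma T_mult_adj_T:
  assumes "a \<in> arcs F"
  shows "T a \<otimes> adj (T a) = S (lab a) \<otimes> Q (head F a) \<otimes> adj (S (lab a))"
proof -
  have "T a \<otimes> adj (T a) = S (lab a) \<otimes> (Q (head F a) \<otimes> Q (head F a)) \<otimes> adj (S (lab a))"
    unfolding split_S_def using assms by (simp add: adj_mult mult_assoc del: Q_simps(2))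
  then show ?thesis
    using assms by simp
qed

text \<open>Each summand is \<open>S f \<otimes> Q (head F a) \<otimes> adj (S f)\<close>; over all
  copies of \<open>f\<close> the middle factors add up to the projection of the range of
  \<open>f\<close>, which \<open>S f\<close> absorbs.\<close>

lemma finsum_T_mult_adj_T:
  assumes f: "f \<in> arcs E"
  shows "(\<Oplus>a\<in>arcs_over f. T a \<otimes> adj (T a)) = S f \<otimes> adj (S f)"
proof -
  have "(\<Oplus>a\<in>arcs_over f. T a \<otimes> adj (T a)) = (\<Oplus>a\<in>arcs_over f. S f \<otimes> Q (head F a) \<otimes> adj (S f))"
    using f by (intro finsum_cong') (auto simp: T_mult_adj_T)
  also have "\<dots> = (\<Oplus>a\<in>arcs_over f. S f \<otimes> Q (head F a)) \<otimes> adj (S f)"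
    using f by (intro finsum_mult_left[symmetric]) auto
  also have "(\<Oplus>a\<in>arcs_over f. S f \<otimes> Q (head F a)) = S f \<otimes> (\<Oplus>a\<in>arcs_over f. Q (head F a))"
    using f by (intro finsum_mult_right[symmetric]) auto
  also have "\<dots> = S f"
    using f by (simp add: finsum_arcs_over S_mult_P_head)
  finally show ?thesis .
qed

lemma Q_eq_finsum:
  assumes "y \<in> tail F ` arcs F"
  shows "Q y = (\<Oplus>a\<in>out_arcs F y. T a \<otimes> adj (T a))"
proof -
  have y: "y \<in> lift ` arcs E" "y \<in> verts F"
    using assms by (auto simp: tail_eq_lift)
  have "(\<Oplus>a\<in>out_arcs F y. T a \<otimes> adj (T a))
      = (\<Oplus>f\<in>part y. \<Oplus>a\<in>{a \<in> out_arcs F y. lab a = f}. T a \<otimes> adj (T a))"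
    using y finite_part row_finite_split[OF row_finite]
    by (intro finsum_fibres) (auto simp: row_finite_def tail_eq_lift)
  also have "\<dots> = (\<Oplus>f\<in>part y. S f \<otimes> adj (S f))"
  proof (rule finsum_cong'[OF refl])
    fix f assume f: "f \<in> part y"
    then have "{a \<in> out_arcs F y. lab a = f} = arcs_over f"
      by (auto simp: tail_eq_lift)
    then show "(\<Oplus>a\<in>{a \<in> out_arcs F y. lab a = f}. T a \<otimes> adj (T a)) = S f \<otimes> adj (S f)"
      using f finsum_T_mult_adj_T by simp
  qed auto
  finally show ?thesis
    using y by (simp add: split_P_def)
qed

lemma cuntz_krieger_family_split: "cuntz_krieger_family F A Q T"
  unfolding cuntz_krieger_family_def
  by (intro conjI ballI impI Q_projection Q_orthogonal partial_isometry_T adj_T_mult_T Q_eq_finsum)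

lemma merge_split_P: "u \<in> verts E \<Longrightarrow> merge_P A Q u = P u"
  by (simp add: merge_P_def finsum_Q_fibre)

lemma merge_split_S:
  assumes f: "f \<in> arcs E"
  shows "merge_S A T f = S f"
proof -
  have "merge_S A T f = (\<Oplus>a\<in>arcs_over f. S f \<otimes> Q (head F a))"
    unfolding merge_S_def using f by (intro finsum_cong') (auto simp: split_S_def)
  also have "\<dots> = S f \<otimes> (\<Oplus>a\<in>arcs_over f. Q (head F a))"
    using f by (intro finsum_mult_right[symmetric]) auto
  finally show ?thesis
    using f by (simp add: finsum_arcs_over S_mult_P_head)
qed

end

section \<open>Merging a Cuntz-Krieger family\<close>

locale merge_family = out_split E F pr lift lab + ck_family A F Q T
  for A :: "'a cstar" (structure) and E :: "('v, 'e) pre_digraph"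
    and F :: "('w, 'f) pre_digraph" and pr lift lab Q T
begin

abbreviation P' :: "'v \<Rightarrow> 'a" where "P' \<equiv> merge_P A Q"
abbreviation S' :: "'e \<Rightarrow> 'a" where "S' \<equiv> merge_S A T"

lemma merge_P_projection: "projection A (P' u)"
  unfolding merge_P_def by (intro projection_finsum finite_fibre P_projection P_orthogonal) auto

lemma merge_P_simps [simp]:
  shows "P' u \<in> carrier A" "P' u \<otimes> P' u = P' u" "adj (P' u) = P' u"
  using merge_P_projection[of u] by (simp_all add: projection_def)

lemma merge_P_orthogonal:
  assumes "u \<noteq> v"
  shows "P' u \<otimes> P' v = \<zero>"
proof -
  have "P' u \<otimes> P' v = (\<Oplus>y\<in>fibre u. Q y \<otimes> P' v)"
    unfolding merge_P_def[of A Q u] by (intro finsum_mult_left) auto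
  also have "\<dots> = \<zero>"
  proof (rule finsum_eq_zero)
    fix y assume y: "y \<in> fibre u"
    then have "Q y \<otimes> P' v = (\<Oplus>z\<in>fibre v. Q y \<otimes> Q z)"
      unfolding merge_P_def by (intro finsum_mult_right) auto
    also have "\<dots> = \<zero>"
      using y assms by (intro finsum_eq_zero P_orthogonal) auto
    finally show "Q y \<otimes> P' v = \<zero>" .
  qed
  finally show ?thesis .
qed

lemma merge_S_closed [simp]: "S' f \<in> carrier A"
  unfolding merge_S_def by (rule finsum_closed) auto

lemma finsum_arcs_over:
  assumes "f \<in> arcs E"
  shows "(\<Oplus>a\<in>arcs_over f. Q (head F a)) = P' (head E f)"
  unfolding merge_P_def
  by (rule finsum_image_eq[OF inj_on_head head_arcs_over[OF assms], symmetric]) auto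

lemma head_neq_if_same_lab:
  "\<lbrakk>a \<in> arcs_over f; b \<in> arcs_over f; a \<noteq> b\<rbrakk> \<Longrightarrow> head F a \<noteq> head F b"
  using arc_eqI by auto

lemma adj_merge_S: "adj (S' f) = (\<Oplus>a\<in>arcs_over f. adj (T a))"
  unfolding merge_S_def by (rule adj_finsum) auto

text \<open>The mixed terms vanish by \<open>adj_S_mult_S_eq_zero\<close>, applied to
  \<open>F\<close>. Copies of one edge share their source, so this is the case that depends on the
  row sums.\<close>

lemma adj_merge_S_mult_merge_S:
  assumes f: "f \<in> arcs E"
  shows "adj (S' f) \<otimes> S' f = P' (head E f)"
proof -
  have "adj (S' f) \<otimes> S' f = (\<Oplus>a\<in>arcs_over f. adj (T a) \<otimes> T a)"
    unfolding adj_merge_S unfolding merge_S_def using f finite_arcs_over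
    by (intro finsum_mult_finsum_orthogonal adj_S_mult_S_eq_zero) auto
  also have "\<dots> = (\<Oplus>a\<in>arcs_over f. Q (head F a))"
    by (intro finsum_cong') (auto simp: adj_S_mult_S)
  finally show ?thesis
    using f by (simp add: finsum_arcs_over)
qed

lemma merge_S_mult_adj_merge_S:
  assumes f: "f \<in> arcs E"
  shows "S' f \<otimes> adj (S' f) = (\<Oplus>a\<in>arcs_over f. T a \<otimes> adj (T a))"
  unfolding adj_merge_S unfolding merge_S_def using f finite_arcs_over
  by (intro finsum_mult_finsum_orthogonal S_mult_adj_S_eq_zero head_neq_if_same_lab) auto

lemma partial_isometry_merge_S:
  assumes f: "f \<in> arcs E"
  shows "partial_isometry A (S' f)"
proof -
  have "S' f \<otimes> P' (head E f) = (\<Oplus>a\<in>arcs_over f. T a \<otimes> Q (head F a))"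
    unfolding finsum_arcs_over[OF f, symmetric] unfolding merge_S_def using f finite_arcs_over
    by (intro finsum_mult_finsum_orthogonal S_mult_P_eq_zero head_neq_if_same_lab) auto
  also have "\<dots> = S' f"
    unfolding merge_S_def by (intro finsum_cong') (auto simp: S_mult_P_head)
  finally show ?thesis
    using f by (simp add: partial_isometry_def mult_assoc adj_merge_S_mult_merge_S)
qed

lemma Q_lift_eq_finsum:
  assumes "y \<in> lift ` arcs E"
  shows "Q y = (\<Oplus>a\<in>out_arcs F y. T a \<otimes> adj (T a))"
proof -
  obtain a where "a \<in> arcs F" "y = tail F a"
    using assms ex_arc_over by (auto simp: tail_eq_lift)
  then show ?thesis
    using P_tail_eq_finsum by simp
qed

lemma finite_part: "y \<in> verts F \<Longrightarrow> finite (part y)"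
  using row_finite_unsplit[OF row_finite]
  by (intro finite_subset[of "part y" "out_arcs E (pr y)"]) (auto simp: row_finite_def)

text \<open>Double counting of the arcs that leave copies of \<open>v\<close>: grouped by source
  they give the projections \<open>Q y\<close>, grouped by label they give the range projections of
  the merged edges. All copies take part because \<open>v\<close> emits an edge.\<close>

lemma merge_P_eq_finsum:
  assumes "v \<in> tail E ` arcs E"
  shows "P' v = (\<Oplus>f\<in>out_arcs E v. S' f \<otimes> adj (S' f))"
proof -
  let ?I = "{a \<in> arcs F. pr (tail F a) = v}" and ?p = "\<lambda>a. T a \<otimes> adj (T a)"
  have "?I \<subseteq> (\<Union>y\<in>fibre v. out_arcs F y)"
    by auto
  moreover have "finite (\<Union>y\<in>fibre v. out_arcs F y)"
    using finite_fibre finite_out_arcs by auto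
  ultimately have fin: "finite ?I"
    by (rule finite_subset)
  have lifts: "fibre v \<subseteq> lift ` arcs E"
    using assms fibre_subset_lift by auto
  have v: "v \<in> verts E"
    using assms by auto
  have p: "?p \<in> J \<rightarrow> carrier A" if "J \<subseteq> arcs F" for J
    using that by auto
  have "P' v = (\<Oplus>y\<in>fibre v. \<Oplus>a\<in>{a \<in> ?I. tail F a = y}. ?p a)"
    unfolding merge_P_def
  proof (rule finsum_cong'[OF refl])
    fix y assume y: "y \<in> fibre v"
    then have "out_arcs F y = {a \<in> ?I. tail F a = y}"
      by auto
    moreover have "Q y = (\<Oplus>a\<in>out_arcs F y. ?p a)"
      using y lifts by (intro Q_lift_eq_finsum) auto
    ultimately show "Q y = (\<Oplus>a\<in>{a \<in> ?I. tail F a = y}. ?p a)"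
      by (simp only:)
  qed (auto intro!: finsum_closed p)
  also have "\<dots> = finsum A ?p ?I"
    using fin finite_fibre by (intro finsum_fibres[symmetric] p) auto
  also have "\<dots> = (\<Oplus>f\<in>out_arcs E v. \<Oplus>a\<in>{a \<in> ?I. lab a = f}. ?p a)"
    using fin row_finite_unsplit[OF row_finite] v
    by (intro finsum_fibres p) (auto simp: row_finite_def tail_eq_lift)
  also have "\<dots> = (\<Oplus>f\<in>out_arcs E v. S' f \<otimes> adj (S' f))"
  proof (rule finsum_cong'[OF refl])
    fix f assume f: "f \<in> out_arcs E v"
    then have "{a \<in> ?I. lab a = f} = arcs_over f"
      by (auto simp: tail_eq_lift)
    moreover have "S' f \<otimes> adj (S' f) = (\<Oplus>a\<in>arcs_over f. ?p a)"
      using f by (intro merge_S_mult_adj_merge_S) auto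
    ultimately show "(\<Oplus>a\<in>{a \<in> ?I. lab a = f}. ?p a) = S' f \<otimes> adj (S' f)"
      by (simp only:)
  qed auto
  finally show ?thesis .
qed

lemma cuntz_krieger_family_merge: "cuntz_krieger_family E A P' S'"
  unfolding cuntz_krieger_family_def
  by (intro conjI ballI impI merge_P_projection merge_P_orthogonal partial_isometry_merge_S
      adj_merge_S_mult_merge_S merge_P_eq_finsum)

lemma split_merge_P:
  assumes y: "y \<in> verts F"
  shows "split_P A P' S' y = Q y"
proof (cases "y \<in> lift ` arcs E")
  case True
  have "split_P A P' S' y = (\<Oplus>f\<in>part y. \<Oplus>a\<in>{a \<in> out_arcs F y. lab a = f}. T a \<otimes> adj (T a))"
    unfolding split_P_def if_P[OF True]
  proof (rule finsum_cong'[OF refl])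
    fix f assume f: "f \<in> part y"
    then have "{a \<in> out_arcs F y. lab a = f} = arcs_over f"
      by (auto simp: tail_eq_lift)
    then show "S' f \<otimes> adj (S' f) = (\<Oplus>a\<in>{a \<in> out_arcs F y. lab a = f}. T a \<otimes> adj (T a))"
      using f by (simp add: merge_S_mult_adj_merge_S)
  qed auto
  also have "\<dots> = (\<Oplus>a\<in>out_arcs F y. T a \<otimes> adj (T a))"
    using y finite_part finite_out_arcs by (intro finsum_fibres[symmetric]) (auto simp: tail_eq_lift)
  finally show ?thesis
    using Q_lift_eq_finsum[OF True] by simp
next
  case False
  then show ?thesis
    using y fibre_of_non_lift by (simp add: split_P_def merge_P_def)
qed

text \<open>The copies of one edge have distinct ranges, so the cut-down by
  \<open>Q (head F a)\<close> retains only \<open>T a\<close> from the merged sum.\<close>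

lemma split_merge_S:
  assumes a: "a \<in> arcs F"
  shows "split_S A P' S' a = T a"
proof -
  have "split_S A P' S' a = S' (lab a) \<otimes> Q (head F a)"
    using a by (simp add: split_S_def split_merge_P)
  also have "\<dots> = (\<Oplus>b\<in>arcs_over (lab a). T b \<otimes> Q (head F a))"
    unfolding merge_S_def using a by (intro finsum_mult_left) auto
  also have "\<dots> = T a \<otimes> Q (head F a)"
    using a finite_arcs_over head_neq_if_same_lab
    by (intro finsum_eq_single S_mult_P_eq_zero) auto
  finally show ?thesis
    using a by (simp add: S_mult_P_head)
qed

end

section \<open>Transfer of the universal property\<close>

context out_split
begin

text \<open>The new family is given by finite algebraic expressions in the old one. Together with
  the recovery of either family from the other, this shows that both generate the same
  algebra.\<close>

lemma split_in_subalgebra: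
  assumes "cstar_algebra A" and B: "closed_star_subalgebra A B" and PS: "P ` verts E \<union> S ` arcs E \<subseteq> B"
  shows "split_P A P S ` verts F \<union> split_S A P S ` arcs F \<subseteq> B"
proof -
  interpret cstar_algebra A by fact
  have P: "split_P A P S y \<in> B" if "y \<in> verts F" for y
  proof (cases "y \<in> lift ` arcs E")
    case True
    have "(\<Oplus>\<^bsub>A\<^esub>f\<in>part y. S f \<otimes>\<^bsub>A\<^esub> adj\<^bsub>A\<^esub> (S f)) \<in> B"
      using PS by (intro finsum_in_closed_star_subalgebra[OF B] closed_star_subalgebraD[OF B]) auto
    then show ?thesis
      using True by (simp add: split_P_def)
  next
    case False
    have "P (pr y) \<in> P ` verts E"
      using that by simp
    then show ?thesis
      using False PS by (simp add: split_P_def) blast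
  qed
  have S: "split_S A P S a \<in> B" if "a \<in> arcs F" for a
  proof -
    have "S (lab a) \<in> S ` arcs E"
      using that by simp
    then have "S (lab a) \<in> B"
      using PS by blast
    then show ?thesis
      using P that by (simp add: split_S_def closed_star_subalgebraD[OF B])
  qed
  show ?thesis
    using P S by auto
qed

lemma merge_in_subalgebra:
  assumes "cstar_algebra A" and B: "closed_star_subalgebra A B" and QT: "Q ` verts F \<union> T ` arcs F \<subseteq> B"
  shows "merge_P A Q ` verts E \<union> merge_S A T ` arcs E \<subseteq> B"
proof -
  interpret cstar_algebra A by fact
  have "merge_P A Q u \<in> B" "merge_S A T f \<in> B" for u f
    unfolding merge_P_def merge_S_def
    using QT by (auto intro!: finsum_in_closed_star_subalgebra[OF B])
  then show ?thesis
    by auto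
qed

text \<open>Naturality of splitting: it lets a homomorphism obtained for \<open>E\<close>-families
  be evaluated on the corresponding \<open>F\<close>-families.\<close>

lemma split_hom:
  assumes "cstar_hom A B \<phi>" and PS: "P ` verts E \<union> S ` arcs E \<subseteq> carrier A"
    and P: "\<And>v. v \<in> verts E \<Longrightarrow> \<phi> (P v) = P' v" and S: "\<And>f. f \<in> arcs E \<Longrightarrow> \<phi> (S f) = S' f"
  shows "y \<in> verts F \<Longrightarrow> \<phi> (split_P A P S y) = split_P B P' S' y"
    and "a \<in> arcs F \<Longrightarrow> \<phi> (split_S A P S a) = split_S B P' S' a"
proof -
  interpret cstar_hom A B \<phi> by fact
  have S_car: "S f \<in> carrier A" if "f \<in> arcs E" for f
    using PS that by auto
  have S': "S' f \<in> carrier B" if "f \<in> arcs E" for f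
    using S[OF that] S_car[OF that] hom_simps(1) by metis
  have *: "\<phi> (split_P A P S y) = split_P B P' S' y" if "y \<in> verts F" for y
  proof (cases "y \<in> lift ` arcs E")
    case True
    have "\<phi> (\<Oplus>\<^bsub>A\<^esub>f\<in>part y. S f \<otimes>\<^bsub>A\<^esub> adj\<^bsub>A\<^esub> (S f)) = (\<Oplus>\<^bsub>B\<^esub>f\<in>part y. \<phi> (S f \<otimes>\<^bsub>A\<^esub> adj\<^bsub>A\<^esub> (S f)))"
      using S_car by (intro hom_finsum) auto
    also have "\<dots> = (\<Oplus>\<^bsub>B\<^esub>f\<in>part y. S' f \<otimes>\<^bsub>B\<^esub> adj\<^bsub>B\<^esub> (S' f))"
      using S_car S' by (intro cod.finsum_cong') (auto simp: S)
    finally show ?thesis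
      using True by (simp add: split_P_def)
  next
    case False
    then show ?thesis
      using P that by (simp add: split_P_def)
  qed
  then show "y \<in> verts F \<Longrightarrow> \<phi> (split_P A P S y) = split_P B P' S' y" .
  have "split_P A P S y \<in> carrier A" if "y \<in> verts F" for y
  proof -
    have "P (pr y) \<in> P ` verts E"
      using that by simp
    then have "P (pr y) \<in> carrier A"
      using PS by blast
    then show ?thesis
      using S_car by (auto simp: split_P_def intro!: dom.finsum_closed)
  qed
  then show "\<phi> (split_S A P S a) = split_S B P' S' a" if "a \<in> arcs F"
    using that S_car S * by (simp add: split_S_def)
qed

lemma merge_hom:
  assumes "cstar_hom A B \<phi>" and QT: "Q ` verts F \<union> T ` arcs F \<subseteq> carrier A"
    and Q: "\<And>y. y \<in> verts F \<Longrightarrow> \<phi> (Q y) = Q' y" and T: "\<And>a. a \<in> arcs F \<Longrightarrow> \<phi> (T a) = T' a"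
  shows "\<phi> (merge_P A Q u) = merge_P B Q' u" and "\<phi> (merge_S A T f) = merge_S B T' f"
proof -
  interpret cstar_hom A B \<phi> by fact
  have car: "Q y \<in> carrier A" if "y \<in> verts F" for y
    using QT that by auto
  have car': "T a \<in> carrier A" if "a \<in> arcs F" for a
    using QT that by auto
  have "Q' y \<in> carrier B" if "y \<in> verts F" for y
    using Q[OF that] car[OF that] hom_simps(1) by metis
  moreover have "\<phi> (merge_P A Q u) = (\<Oplus>\<^bsub>B\<^esub>y\<in>fibre u. \<phi> (Q y))"
    unfolding merge_P_def using car by (intro hom_finsum) auto
  ultimately show "\<phi> (merge_P A Q u) = merge_P B Q' u"
    using cod.finsum_cong'[of "fibre u" "fibre u" Q' "\<lambda>y. \<phi> (Q y)"] Q
    by (auto simp: merge_P_def)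
  have "T' a \<in> carrier B" if "a \<in> arcs F" for a
    using T[OF that] car'[OF that] hom_simps(1) by metis
  moreover have "\<phi> (merge_S A T f) = (\<Oplus>\<^bsub>B\<^esub>a\<in>arcs_over f. \<phi> (T a))"
    unfolding merge_S_def using car' by (intro hom_finsum) auto
  ultimately show "\<phi> (merge_S A T f) = merge_S B T' f"
    using cod.finsum_cong'[of "arcs_over f" "arcs_over f" T' "\<lambda>a. \<phi> (T a)"] T
    by (auto simp: merge_S_def)
qed

lemma split_familyI:
  assumes "cstar_algebra A" "row_finite E" "cuntz_krieger_family E A P S"
  shows "split_family A E F pr lift lab P S"
  using assms out_split_axioms base.nomulti_digraph
  by (simp add: split_family_def ck_family_def ck_family_axioms_def)

lemma merge_familyI:
  assumes "cstar_algebra A" "row_finite E" "cuntz_krieger_family F A Q T"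
  shows "merge_family A E F pr lift lab Q T"
  using assms out_split_axioms nomulti_split row_finite_split
  by (simp add: merge_family_def ck_family_def ck_family_axioms_def)

text \<open>To map onto a given \<open>F\<close>-family, merge it, use the universal property for
  \<open>E\<close>, and split the result. Splitting commutes with the homomorphism and undoes the
  merging, so the given family comes back.\<close>

theorem is_graph_algebra_split:
  fixes A :: "'a cstar"
  assumes rf: "row_finite E" and "is_graph_algebra E A"
  shows "is_graph_algebra F A"
proof -
  obtain P S where A: "cstar_algebra A" and ck: "cuntz_krieger_family E A P S"
    and gen: "generates_cstar A (P ` verts E \<union> S ` arcs E)"
    and univ: "\<And>(B :: real cstar) P' S'. cstar_algebra B \<Longrightarrow> cuntz_krieger_family E B P' S' \<Longrightarrow>
        \<exists>\<phi>. star_hom A B \<phi> \<and> (\<forall>v \<in> verts E. \<phi> (P v) = P' v) \<and> (\<forall>e \<in> arcs E. \<phi> (S e) = S' e)"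
    using assms(2) unfolding is_graph_algebra_def by blast
  interpret A: split_family A E F pr lift lab P S
    by (rule split_familyI[OF A rf ck])
  note PS = cuntz_krieger_family_in_carrier[OF ck]
  have "generates_cstar A (A.Q ` verts F \<union> A.T ` arcs F)"
  proof (rule generates_cstarI[OF gen cuntz_krieger_family_in_carrier[OF A.cuntz_krieger_family_split]])
    fix B assume "closed_star_subalgebra A B" "A.Q ` verts F \<union> A.T ` arcs F \<subseteq> B"
    from merge_in_subalgebra[OF A this] show "P ` verts E \<union> S ` arcs E \<subseteq> B"
      by (simp add: A.merge_split_P A.merge_split_S cong: image_cong_simp)
  qed
  moreover have "\<exists>\<phi>. star_hom A B \<phi> \<and> (\<forall>y \<in> verts F. \<phi> (A.Q y) = Q y) \<and> (\<forall>a \<in> arcs F. \<phi> (A.T a) = T a)"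
    if B: "cstar_algebra B" "cuntz_krieger_family F B Q T" for B :: "real cstar" and Q T
  proof -
    interpret B: merge_family B E F pr lift lab Q T
      by (rule merge_familyI[OF B(1) rf B(2)])
    obtain \<phi> where \<phi>: "star_hom A B \<phi>" "\<And>v. v \<in> verts E \<Longrightarrow> \<phi> (P v) = B.P' v"
      "\<And>e. e \<in> arcs E \<Longrightarrow> \<phi> (S e) = B.S' e"
      using univ[OF B(1) B.cuntz_krieger_family_merge] by blast
    have "cstar_hom A B \<phi>"
      using A B \<phi> by (simp add: cstar_hom_def cstar_hom_axioms_def)
    note split_hom[OF this PS \<phi>(2,3)]
    then show ?thesis
      using \<phi>(1) by (intro exI[of _ \<phi>]) (simp add: B.split_merge_P B.split_merge_S)
  qed
  ultimately show ?thesis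
    unfolding is_graph_algebra_def using A A.cuntz_krieger_family_split by blast
qed

theorem is_graph_algebra_unsplit:
  fixes A :: "'a cstar"
  assumes rf: "row_finite E" and "is_graph_algebra F A"
  shows "is_graph_algebra E A"
proof -
  obtain Q T where A: "cstar_algebra A" and ck: "cuntz_krieger_family F A Q T"
    and gen: "generates_cstar A (Q ` verts F \<union> T ` arcs F)"
    and univ: "\<And>(B :: real cstar) Q' T'. cstar_algebra B \<Longrightarrow> cuntz_krieger_family F B Q' T' \<Longrightarrow>
        \<exists>\<phi>. star_hom A B \<phi> \<and> (\<forall>y \<in> verts F. \<phi> (Q y) = Q' y) \<and> (\<forall>a \<in> arcs F. \<phi> (T a) = T' a)"
    using assms(2) unfolding is_graph_algebra_def by blast
  interpret A: merge_family A E F pr lift lab Q T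
    by (rule merge_familyI[OF A rf ck])
  note QT = cuntz_krieger_family_in_carrier[OF ck]
  have "generates_cstar A (A.P' ` verts E \<union> A.S' ` arcs E)"
  proof (rule generates_cstarI[OF gen cuntz_krieger_family_in_carrier[OF A.cuntz_krieger_family_merge]])
    fix B assume "closed_star_subalgebra A B" "A.P' ` verts E \<union> A.S' ` arcs E \<subseteq> B"
    from split_in_subalgebra[OF A this] show "Q ` verts F \<union> T ` arcs F \<subseteq> B"
      by (simp add: A.split_merge_P A.split_merge_S cong: image_cong_simp)
  qed
  moreover have "\<exists>\<phi>. star_hom A B \<phi> \<and> (\<forall>v \<in> verts E. \<phi> (A.P' v) = P v) \<and> (\<forall>e \<in> arcs E. \<phi> (A.S' e) = S e)"
    if B: "cstar_algebra B" "cuntz_krieger_family E B P S" for B :: "real cstar" and P S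
  proof -
    interpret B: split_family B E F pr lift lab P S
      by (rule split_familyI[OF B(1) rf B(2)])
    obtain \<phi> where \<phi>: "star_hom A B \<phi>" "\<And>y. y \<in> verts F \<Longrightarrow> \<phi> (Q y) = B.Q y"
      "\<And>a. a \<in> arcs F \<Longrightarrow> \<phi> (T a) = B.T a"
      using univ[OF B(1) B.cuntz_krieger_family_split] by blast
    have "cstar_hom A B \<phi>"
      using A B \<phi> by (simp add: cstar_hom_def cstar_hom_axioms_def)
    note merge_hom[OF this QT \<phi>(2,3)]
    then show ?thesis
      using \<phi>(1) by (intro exI[of _ \<phi>]) (simp add: B.merge_split_P B.merge_split_S)
  qed
  ultimately show ?thesis
    unfolding is_graph_algebra_def using A A.cuntz_krieger_family_merge by blast
qed

end

section \<open>Isomorphisms and edge explosions as out-splittings\<close>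

lemma out_split_if_digraph_iso:
  assumes "nomulti_digraph E" "digraph_iso E F"
  shows "\<exists>pr lift lab. out_split E F pr lift lab"
proof -
  interpret nomulti_digraph E by fact
  obtain hom where hom: "digraph_isomorphism hom" and F: "F = app_iso hom E"
    using assms(2) by (auto simp: digraph_iso_def)
  let ?pr = "iso_verts (inv_iso hom)" and ?lab = "iso_arcs (inv_iso hom)"
  note [simp] = iso_verts_inv_iso[OF hom] iso_arcs_inv_iso[OF hom] iso_verts_eq_iff[OF hom]
    iso_arcs_eq_iff[OF hom] iso_verts_tail[OF hom] iso_verts_head[OF hom]
  \<comment> \<open>All fibres are singletons, so \<open>lift_if_split\<close> holds
    vacuously.\<close>
  have "out_split E F ?pr (iso_verts hom \<circ> tail E) ?lab"
  proof (unfold_locales)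
    show "?pr ` verts F = verts E"
      using verts_app_inv_iso[OF hom] by (simp add: F)
    show "finite {y \<in> verts F. ?pr y = u}" for u
      by (rule finite_subset[of _ "{iso_verts hom u}"]) (auto simp: F)
  qed (auto simp: F)
  then show ?thesis
    by blast
qed

text \<open>\<open>Primed\<close> emits the copies of \<open>e\<close>; the second hypothesis on
  \<open>e\<close> supplies another edge from the same vertex, so \<open>Doubly_Primed\<close> emits
  edges too, as \<open>lift_if_split\<close> demands.\<close>

lemma out_split_explode:
  assumes "nomulti_digraph E" and e: "e \<in> arcs E" and e': "out_arcs E (tail E e) \<noteq> {e}"
  shows "\<exists>pr lift lab. out_split E (explode E e) pr lift lab"
proof -
  interpret nomulti_digraph E by fact
  let ?F = "explode E e" and ?v = "tail E e"
  define pr where "pr y = (case y of Old u \<Rightarrow> u | Primed \<Rightarrow> ?v | Doubly_Primed \<Rightarrow> ?v)" for y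
  define lift where "lift f = (if f = e then Primed else if tail E f = ?v then Doubly_Primed
    else Old (tail E f))" for f
  \<comment> \<open>Arcs of the explosion are mere pairs of vertices and do not remember their edge;
    it is recovered from its projected ends, uniquely as there are no multiple edges.\<close>
  define lab where "lab a = (THE f. f \<in> arcs E \<and> tail E f = pr (fst a) \<and> head E f = pr (snd a))"
    for a :: "'a exploded \<times> 'a exploded"
  have pr_simps [simp]: "pr (Old u) = u" "pr Primed = ?v" "pr Doubly_Primed = ?v" for u
    by (simp_all add: pr_def)
  have verts: "verts ?F = {y. pr y \<in> verts E \<and> y \<noteq> Old ?v}"
  proof (rule Set.set_eqI)
    show "y \<in> verts ?F \<longleftrightarrow> y \<in> {y. pr y \<in> verts E \<and> y \<noteq> Old ?v}" for y
      using e by (cases y) (auto simp: explode_def Let_def)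
  qed
  have lift_Old: "lift f = Old (tail E f)" if "tail E f \<noteq> ?v" for f
    using that by (auto simp: lift_def)
  have lift_Primed: "lift e = Primed"
    by (simp add: lift_def)
  have lift_Doubly_Primed: "lift f = Doubly_Primed" if "tail E f = ?v" "f \<noteq> e" for f
    using that by (simp add: lift_def)
  \<comment> \<open>The clauses of \<open>explode\<close> have this one description: an edge departs
    from its lift and goes to every copy of its range. The vertex \<open>Old ?v\<close> has to be
    excluded because \<open>pr\<close> sends it to \<open>?v\<close> although it is no vertex of the
    explosion.\<close>
  define X where "X = {(lift f, y) |f y. f \<in> arcs E \<and> y \<noteq> Old ?v \<and> pr y = head E f}"
  have X: "(lift f, y) \<in> X" if "f \<in> arcs E" "y \<noteq> Old ?v" "pr y = head E f" for f y
    using that by (auto simp: X_def)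
  have "a \<in> X" if "a \<in> arcs ?F" for a
  proof -
    consider f where "f \<in> arcs E" "tail E f \<noteq> ?v" "head E f \<noteq> ?v" "a = (Old (tail E f), Old (head E f))"
      | f y where "f \<in> arcs E" "tail E f \<noteq> ?v" "head E f = ?v" "y \<in> {Primed, Doubly_Primed}"
        "a = (Old (tail E f), y)"
      | "head E e \<noteq> ?v" "a = (Primed, Old (head E e))"
      | f where "f \<in> arcs E" "tail E f = ?v" "f \<noteq> e" "head E f \<noteq> ?v" "a = (Doubly_Primed, Old (head E f))"
      | y where "head E e = ?v" "y \<in> {Primed, Doubly_Primed}" "a = (Primed, y)"
      | f y where "f \<in> arcs E" "tail E f = ?v" "f \<noteq> e" "head E f = ?v" "y \<in> {Primed, Doubly_Primed}"
        "a = (Doubly_Primed, y)"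
      using \<open>a \<in> arcs ?F\<close> unfolding explode_def Let_def by fastforce
    then show ?thesis
    proof cases
      case (1 f)
      then show ?thesis
        using X[of f "Old (head E f)"] by (simp add: lift_Old)
    next
      case (2 f y)
      then show ?thesis
        using X[of f y] by (auto simp: lift_Old)
    next
      case 3
      then show ?thesis
        using X[of e "Old (head E e)"] e by (simp add: lift_Primed)
    next
      case (4 f)
      then show ?thesis
        using X[of f "Old (head E f)"] by (simp add: lift_Doubly_Primed)
    next
      case (5 y)
      then show ?thesis
        using X[of e y] e by (auto simp: lift_Primed)
    next
      case (6 f y)
      then show ?thesis
        using X[of f y] by (auto simp: lift_Doubly_Primed)
    qed
  qed
  moreover have "(lift f, y) \<in> arcs ?F" if "f \<in> arcs E" "y \<noteq> Old ?v" "pr y = head E f" for f y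
  proof -
    consider "f = e" | "f \<noteq> e" "tail E f = ?v" | "tail E f \<noteq> ?v"
      by blast
    then show ?thesis
    proof cases
      case 1
      then show ?thesis
        using that by (cases y) (auto simp: explode_def Let_def lift_Primed)
    next
      case 2
      then show ?thesis
        using that by (cases y) (auto simp: explode_def Let_def lift_Doubly_Primed)
    next
      case 3
      then show ?thesis
        using that by (cases y) (auto simp: explode_def Let_def lift_Old)
    qed
  qed
  ultimately have arcs: "arcs ?F = X"
    by (auto simp: X_def)
  have tail_head: "tail ?F = fst" "head ?F = snd"
    by (simp_all add: explode_def Let_def)
  have pr_lift: "pr (lift f) = tail E f" for f
    by (simp add: lift_def)
  have lift_neq: "lift f \<noteq> Old ?v" for f
    by (simp add: lift_def)
  have lab: "lab (lift f, y) = f" if "f \<in> arcs E" "pr y = head E f" for f y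
    unfolding lab_def using that no_multi_arcs
    by (intro the_equality) (auto simp: pr_lift arc_to_ends_def)
  have "{e} \<subset> out_arcs E ?v"
    using e e' by auto
  then obtain f where "f \<in> out_arcs E ?v - {e}"
    using psubset_imp_ex_mem by fast
  then have f: "f \<in> arcs E" "tail E f = ?v" "f \<noteq> e"
    by auto
  have "out_split E ?F pr lift lab"
  proof (unfold_locales)
    show "pr ` verts ?F = verts E"
    proof
      show "pr ` verts ?F \<subseteq> verts E"
        by (auto simp: verts)
      show "verts E \<subseteq> pr ` verts ?F"
      proof
        fix u assume "u \<in> verts E"
        then show "u \<in> pr ` verts ?F"
          by (intro image_eqI[of _ _ "if u = ?v then Primed else Old u"]) (auto simp: verts)
      qed
    qed
    show "finite {y \<in> verts ?F. pr y = u}" for u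
    proof (rule finite_subset)
      show "{y \<in> verts ?F. pr y = u} \<subseteq> {Old u, Primed, Doubly_Primed}"
      proof
        fix y assume "y \<in> {y \<in> verts ?F. pr y = u}"
        then show "y \<in> {Old u, Primed, Doubly_Primed}"
          by (cases y) auto
      qed
    qed simp
    show "y \<in> lift ` arcs E" if "y \<in> verts ?F" "z \<in> verts ?F" "pr y = pr z" "y \<noteq> z" for y z
    proof -
      have "y \<in> {Primed, Doubly_Primed}"
        using that by (cases y; cases z) (auto simp: verts)
      moreover have "lift e = Primed" "lift f = Doubly_Primed"
        using f by (simp_all add: lift_def)
      ultimately show ?thesis
        using e f(1) by (metis image_eqI insertE singletonD)
    qed
  qed (auto simp: verts arcs X_def tail_head lab pr_lift lift_neq)
  then show ?thesis
    by blast
qed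

text \<open>The third conclusion allows another out-splitting to follow, as happens when an
  explosion is composed with an isomorphism.\<close>

lemma is_graph_algebra_iff_if_out_split:
  assumes "\<exists>pr lift lab. out_split E F pr lift lab"
  shows "row_finite E \<longleftrightarrow> row_finite F"
    and "row_finite E \<Longrightarrow> is_graph_algebra E A \<longleftrightarrow> is_graph_algebra F A"
    and "nomulti_digraph F"
proof -
  obtain pr lift lab where "out_split E F pr lift lab"
    using assms by blast
  then interpret out_split E F pr lift lab .
  show "row_finite E \<longleftrightarrow> row_finite F"
    using row_finite_split row_finite_unsplit by blast
  show "is_graph_algebra E A \<longleftrightarrow> is_graph_algebra F A" if "row_finite E"
    using is_graph_algebra_split is_graph_algebra_unsplit that by blast
  show "nomulti_digraph F"
    by (rule nomulti_split)
qed

lemma edge_explosion_graph_algebra: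
  assumes "nomulti_digraph E" "is_edge_explosion F E"
  shows "row_finite E \<longleftrightarrow> row_finite F"
    and "row_finite E \<Longrightarrow> is_graph_algebra E A \<longleftrightarrow> is_graph_algebra F A"
proof -
  obtain e where e: "e \<in> arcs E" "out_arcs E (tail E e) \<noteq> {e}" "digraph_iso (explode E e) F"
    using assms(2) unfolding is_edge_explosion_def by blast
  note ex = is_graph_algebra_iff_if_out_split[OF out_split_explode[OF assms(1) e(1,2)]]
  note iso = is_graph_algebra_iff_if_out_split[OF out_split_if_digraph_iso[OF ex(3) e(3)]]
  show "row_finite E \<longleftrightarrow> row_finite F"
    using ex(1) iso(1) by simp
  show "is_graph_algebra E A \<longleftrightarrow> is_graph_algebra F A" if "row_finite E"
    using ex(1) ex(2)[of A] iso(2)[of A] that by simp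
qed

text \<open>One and the same algebra \<open>A\<close> is kept while the graph changes along the
  chain, so no isomorphisms have to be composed.\<close>

lemma is_graph_algebra_if_explosion_equivalent:
  assumes "countable_graph E" "row_finite E" "explosion_equivalent E F" "is_graph_algebra E A"
  shows "is_graph_algebra F A"
proof -
  obtain n and G :: "nat \<Rightarrow> (nat, nat) pre_digraph"
    where G: "\<And>i. i \<le> n \<Longrightarrow> countable_graph (G i)" and "digraph_iso E (G 0)" "digraph_iso (G n) F"
    and step: "\<And>i. i < n \<Longrightarrow> is_edge_explosion (G i) (G (Suc i)) \<or> is_edge_explosion (G (Suc i)) (G i)"
    using assms(3) unfolding explosion_equivalent_def by blast
  have nomulti: "nomulti_digraph (G i)" if "i \<le> n" for i
    using G[OF that] by (rule countable_graph.axioms)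
  have E: "nomulti_digraph E"
    using assms(1) by (rule countable_graph.axioms)
  \<comment> \<open>Row-finiteness belongs to the induction claim, since the transfer of the
    universal property asks for it at each step, in whichever direction the explosion goes.\<close>
  have "row_finite (G i) \<and> is_graph_algebra (G i) A" if "i \<le> n" for i
    using that
  proof (induction i)
    case 0
    then show ?case
      using is_graph_algebra_iff_if_out_split(1,2)[OF out_split_if_digraph_iso[OF E \<open>digraph_iso E (G 0)\<close>]]
        assms(2,4) by blast
  next
    case (Suc i)
    then have IH: "row_finite (G i)" "is_graph_algebra (G i) A" and i: "i < n"
      by auto
    from step[OF i] show ?case
    proof
      assume "is_edge_explosion (G i) (G (Suc i))"
      from edge_explosion_graph_algebra(1)[OF nomulti[OF Suc.prems] this]
        edge_explosion_graph_algebra(2)[OF nomulti[OF Suc.prems] this, of A] IH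
      show ?thesis
        by simp
    next
      assume "is_edge_explosion (G (Suc i)) (G i)"
      from edge_explosion_graph_algebra(1)[OF nomulti this]
        edge_explosion_graph_algebra(2)[OF nomulti this, of A] IH i
      show ?thesis
        by simp
    qed
  qed
  then have "row_finite (G n)" "is_graph_algebra (G n) A"
    by auto
  then show ?thesis
    using is_graph_algebra_iff_if_out_split(2)[OF out_split_if_digraph_iso[OF nomulti \<open>digraph_iso (G n) F\<close>]]
    by blast
qed

theorem corollary6p8:
  fixes E :: "('v, 'e) pre_digraph" and F :: "('w, 'f) pre_digraph"
    and A :: "'a cstar" and B :: "'b cstar"
  assumes "countable_graph E" and "row_finite E"
    and "countable_graph F" and "explosion_equivalent E F"
    and "is_graph_algebra E A" and "is_graph_algebra F B"
  shows "cstar_isomorphic A B"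
proof (rule graph_algebra_unique)
  show "is_graph_algebra F A"
    using assms by (intro is_graph_algebra_if_explosion_equivalent[of E F])
  show "countable (verts F)" "countable (arcs F)"
    using assms(3) by (auto simp: countable_graph_def countable_graph_axioms_def)
qed (rule assms)

end
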